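(* Let $\Gamma$ and $\Delta$ be groups, and let $G=(V,E)$ be a simplicial graph on which $\Gamma$ acts on the left by graph automorphisms. Then the graph wreath product $G(\Delta)\rtimes\Gamma$ is residually finite if and only if all of the following hold: (1) $\Gamma$ and $\Delta$ are residually finite; (2) either $\Delta$ is abelian and for all neighbouring $v,w\in V$ there is a finite index subgroup $K\leq\Gamma$ such that $w\notin Kv$, or for all $v\in V$ there is some finite index subgroup $K\leq\Gamma$ such that $Kv\cap N(v)=\emptyset$; (3) for all $v,w\in V$ that are not neighbouring and not equal, there is a finite index subgroup $K\leq\Gamma$ such that $Kw\cap(N(v)\cup\{v\})=\emptyset$.
   Context: All graphs are simplicial: every edge joins two distinct vertices and is determined by its endpoints (graphs may be infinite). $N(v)$ denotes the set of neighbours of a vertex $v$, and $Kv=\{kv: k\in K\}$. The graph product $G(\Delta)$ is the quotient of the free product $\ast_{v\in V}\Delta_{(v)}$ of copies $\Delta_{(v)}$ of $\Delta$ indexed by $V$ by the normal closure of all commutators $[\Delta_{(v)},\Delta_{(w)}]$ with $(v,w)\in E$. For $g\in\Delta$, $g_{(v)}$ denotes the corresponding element of $\Delta_{(v)}$. The group $\Gamma$ acts on $G(\Delta)$ by automorphisms via $\gamma\cdot g_{(v)}=g_{(\gamma v)}$. The graph wreath product $G(\Delta)\rtimes\Gamma$ is the semidirect product for this action. A group is residually finite if every non-identity element has non-trivial image under some homomorphism to a finite group.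
   Formalization: The formal theorem additionally assumes that V is non-empty and that Δ is non-trivial; without these the graph product is trivial and the equivalence can fail (e.g. V empty, Γ trivial, Δ = Q). *)

theory Defs
  imports "HOL-Algebra.Group_Action"
begin

section \<open>Residual finiteness\<close>

text \<open>
  HOL cannot quantify over the type of the finite target group inside a definition.  Every finite
  group is isomorphic to one whose elements are natural numbers, so ranging over the groups of
  type \<^typ>\<open>nat monoid\<close> is no restriction; see \<open>residually_finiteI\<close> below.
\<close>

definition residually_finite :: "('a, 'm) monoid_scheme \<Rightarrow> bool" where
  "residually_finite G \<longleftrightarrow>
     (\<forall>x \<in> carrier G. x \<noteq> \<one>\<^bsub>G\<^esub> \<longrightarrow>
       (\<exists>(H :: nat monoid) h. group H \<and> finite (carrier H) \<and> h \<in> hom G H \<and> h x \<noteq> \<one>\<^bsub>H\<^esub>))"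

definition finite_index_subgroup :: "('a, 'm) monoid_scheme \<Rightarrow> 'a set \<Rightarrow> bool" where
  "finite_index_subgroup G K \<longleftrightarrow> subgroup K G \<and> finite (rcosets\<^bsub>G\<^esub> K)"

lemma finite_group_nat_copy:
  assumes "group H" "finite (carrier H)"
  obtains H' :: "nat monoid" and f where "group H'" "finite (carrier H')" "f \<in> iso H H'"
proof -
  obtain f :: "_ \<Rightarrow> nat" and n where f: "f ` carrier H = {i. i < n}" "inj_on f (carrier H)"
    using finite_imp_inj_to_nat_seg[OF assms(2)] by blast
  define H' :: "nat monoid" where
    "H' = \<lparr>carrier = f ` carrier H,
           monoid.mult = (\<lambda>x y. f (inv_into (carrier H) f x \<otimes>\<^bsub>H\<^esub> inv_into (carrier H) f y)),
           one = f \<one>\<^bsub>H\<^esub>\<rparr>"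
  have iso: "f \<in> iso H H'"
    using f(2) by (auto simp: iso_def hom_def H'_def bij_betw_def)
  have "H' = H'\<lparr>one := f \<one>\<^bsub>H\<^esub>\<rparr>" by (simp add: H'_def)
  moreover have "group (H'\<lparr>one := f \<one>\<^bsub>H\<^esub>\<rparr>)"
    by (rule group.iso_imp_img_group[OF assms(1) iso])
  ultimately have "group H'" by simp
  moreover have "finite (carrier H')" using assms(2) by (simp add: H'_def)
  ultimately show thesis using iso that by blast
qed

lemma residually_finiteI:
  assumes "\<And>x. x \<in> carrier G \<Longrightarrow> x \<noteq> \<one>\<^bsub>G\<^esub> \<Longrightarrow>
             \<exists>(H :: 'b monoid) h. group H \<and> finite (carrier H) \<and> h \<in> hom G H \<and> h x \<noteq> \<one>\<^bsub>H\<^esub>"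
  shows "residually_finite G"
  unfolding residually_finite_def
proof (intro ballI impI)
  fix x assume x: "x \<in> carrier G" "x \<noteq> \<one>\<^bsub>G\<^esub>"
  then obtain H :: "'b monoid" and h where
    H: "group H" "finite (carrier H)" "h \<in> hom G H" "h x \<noteq> \<one>\<^bsub>H\<^esub>" using assms(1) by blast
  obtain H' :: "nat monoid" and f where
    H': "group H'" "finite (carrier H')" "f \<in> iso H H'"
    using finite_group_nat_copy[OF H(1,2)] by metis
  have fh: "f \<in> hom H H'" using H'(3) by (simp add: iso_def)
  have "f (h x) \<noteq> f \<one>\<^bsub>H\<^esub>"
    using H'(3) H x(1) group.is_monoid[OF H(1)] monoid.one_closed[of H]
    by (fastforce simp: iso_def bij_betw_def hom_def inj_on_def)
  then have "(f \<circ> h) x \<noteq> \<one>\<^bsub>H'\<^esub>" using hom_one[OF fh H(1) H'(1)] by simp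
  moreover have "f \<circ> h \<in> hom G H'"
    using hom_compose[OF H(3) fh] .
  ultimately show "\<exists>(H :: nat monoid) h. group H \<and> finite (carrier H) \<and> h \<in> hom G H \<and> h x \<noteq> \<one>\<^bsub>H\<^esub>"
    using H' by blast
qed


section \<open>Simplicial graphs\<close>

locale simplicial_graph =
  fixes V :: "'v set" and E :: "'v set set"
  assumes edges: "e \<in> E \<Longrightarrow> \<exists>v\<in>V. \<exists>w\<in>V. v \<noteq> w \<and> e = {v, w}"

definition neighbours :: "'v set set \<Rightarrow> 'v \<Rightarrow> 'v set" where
  "neighbours E v = {w. {v, w} \<in> E}"

definition graph_automorphism :: "'v set \<Rightarrow> 'v set set \<Rightarrow> ('v \<Rightarrow> 'v) \<Rightarrow> bool" where
  "graph_automorphism V E f \<longleftrightarrow>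
     bij_betw f V V \<and> (\<forall>v\<in>V. \<forall>w\<in>V. {v, w} \<in> E \<longleftrightarrow> {f v, f w} \<in> E)"


section \<open>Free products\<close>

text \<open>
  The free product of the groups \<open>G i\<close> (\<open>i \<in> I\<close>) consists of the words in the disjoint union of
  the \<open>carrier (G i)\<close>, up to the congruence generated by deleting identity letters and multiplying
  adjacent letters from the same factor.
\<close>

definition free_product_words :: "'i set \<Rightarrow> ('i \<Rightarrow> ('a, 'm) monoid_scheme) \<Rightarrow> ('i \<times> 'a) list set" where
  "free_product_words I G = lists (SIGMA i:I. carrier (G i))"

inductive_set free_product_rel ::
    "'i set \<Rightarrow> ('i \<Rightarrow> ('a, 'm) monoid_scheme) \<Rightarrow> (('i \<times> 'a) list \<times> ('i \<times> 'a) list) set"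
  for I :: "'i set" and G :: "'i \<Rightarrow> ('a, 'm) monoid_scheme"
where
  unit: "\<lbrakk>xs \<in> free_product_words I G; ys \<in> free_product_words I G; i \<in> I\<rbrakk>
     \<Longrightarrow> (xs @ (i, \<one>\<^bsub>G i\<^esub>) # ys, xs @ ys) \<in> free_product_rel I G"
| merge: "\<lbrakk>xs \<in> free_product_words I G; ys \<in> free_product_words I G; i \<in> I;
      a \<in> carrier (G i); b \<in> carrier (G i)\<rbrakk>
     \<Longrightarrow> (xs @ (i, a) # (i, b) # ys, xs @ (i, a \<otimes>\<^bsub>G i\<^esub> b) # ys) \<in> free_product_rel I G"
| refl: "xs \<in> free_product_words I G \<Longrightarrow> (xs, xs) \<in> free_product_rel I G"
| sym: "(xs, ys) \<in> free_product_rel I G \<Longrightarrow> (ys, xs) \<in> free_product_rel I G"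
| trans: "\<lbrakk>(xs, ys) \<in> free_product_rel I G; (ys, zs) \<in> free_product_rel I G\<rbrakk>
     \<Longrightarrow> (xs, zs) \<in> free_product_rel I G"

definition free_product ::
    "'i set \<Rightarrow> ('i \<Rightarrow> ('a, 'm) monoid_scheme) \<Rightarrow> ('i \<times> 'a) list set monoid" where
  "free_product I G =
     \<lparr>carrier = free_product_words I G // free_product_rel I G,
      monoid.mult = (\<lambda>A B. \<Union>xs\<in>A. \<Union>ys\<in>B. free_product_rel I G `` {xs @ ys}),
      one = free_product_rel I G `` {[]}\<rparr>"

definition free_product_inj ::
    "'i set \<Rightarrow> ('i \<Rightarrow> ('a, 'm) monoid_scheme) \<Rightarrow> 'i \<Rightarrow> 'a \<Rightarrow> ('i \<times> 'a) list set" where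
  "free_product_inj I G i a = free_product_rel I G `` {[(i, a)]}"


section \<open>Graph products and graph wreath products\<close>

definition normal_closure :: "('a, 'm) monoid_scheme \<Rightarrow> 'a set \<Rightarrow> 'a set" where
  "normal_closure G S = \<Inter>{N. N \<lhd> G \<and> S \<subseteq> N}"

definition graph_product_commutators ::
    "'v set \<Rightarrow> 'v set set \<Rightarrow> ('d, 'm) monoid_scheme \<Rightarrow> ('v \<times> 'd) list set set" where
  "graph_product_commutators V E \<Delta> =
     (let P = free_product V (\<lambda>_. \<Delta>); \<iota> = free_product_inj V (\<lambda>_. \<Delta>)
      in {\<iota> v a \<otimes>\<^bsub>P\<^esub> \<iota> w b \<otimes>\<^bsub>P\<^esub> inv\<^bsub>P\<^esub> (\<iota> v a) \<otimes>\<^bsub>P\<^esub> inv\<^bsub>P\<^esub> (\<iota> w b) | v w a b.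
            v \<in> V \<and> w \<in> V \<and> {v, w} \<in> E \<and> a \<in> carrier \<Delta> \<and> b \<in> carrier \<Delta>})"

abbreviation graph_product_kernel ::
    "'v set \<Rightarrow> 'v set set \<Rightarrow> ('d, 'm) monoid_scheme \<Rightarrow> ('v \<times> 'd) list set set" where
  "graph_product_kernel V E \<Delta> \<equiv>
     normal_closure (free_product V (\<lambda>_. \<Delta>)) (graph_product_commutators V E \<Delta>)"

definition graph_product ::
    "'v set \<Rightarrow> 'v set set \<Rightarrow> ('d, 'm) monoid_scheme \<Rightarrow> ('v \<times> 'd) list set set monoid" where
  "graph_product V E \<Delta> = free_product V (\<lambda>_. \<Delta>) Mod graph_product_kernel V E \<Delta>"

text \<open>The element \<open>g\<^bsub>(v)\<^esub>\<close> of the graph product.\<close>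

definition graph_product_inj ::
    "'v set \<Rightarrow> 'v set set \<Rightarrow> ('d, 'm) monoid_scheme \<Rightarrow> 'v \<Rightarrow> 'd \<Rightarrow> ('v \<times> 'd) list set set" where
  "graph_product_inj V E \<Delta> v g =
     graph_product_kernel V E \<Delta> #>\<^bsub>free_product V (\<lambda>_. \<Delta>)\<^esub> free_product_inj V (\<lambda>_. \<Delta>) v g"

text \<open>
  An element of the graph product is a coset, that is, a set of classes of words.  A permutation
  \<open>f\<close> of the vertices acts by relabelling all letters of all these words.  Lemmas
  \<open>relabel_graph_product_inj\<close> and \<open>relabel_in_AutoGroup\<close> below show that the resulting
  action is by automorphisms and satisfies \<open>\<gamma> \<cdot> g\<^bsub>(v)\<^esub> = g\<^bsub>(\<gamma> v)\<^esub>\<close>.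
\<close>

definition relabel :: "('v \<Rightarrow> 'v) \<Rightarrow> ('v \<times> 'd) list set set \<Rightarrow> ('v \<times> 'd) list set set" where
  "relabel f X = (\<lambda>A. map (apfst f) ` A) ` X"

definition semidirect_product ::
    "('a, 'm) monoid_scheme \<Rightarrow> ('b, 'n) monoid_scheme \<Rightarrow> ('b \<Rightarrow> 'a \<Rightarrow> 'a) \<Rightarrow> ('a \<times> 'b) monoid" where
  "semidirect_product N Q \<alpha> =
     \<lparr>carrier = carrier N \<times> carrier Q,
      monoid.mult = (\<lambda>(n, q) (n', q'). (n \<otimes>\<^bsub>N\<^esub> \<alpha> q n', q \<otimes>\<^bsub>Q\<^esub> q')),
      one = (\<one>\<^bsub>N\<^esub>, \<one>\<^bsub>Q\<^esub>)\<rparr>"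

definition graph_wreath_product ::
    "'v set \<Rightarrow> 'v set set \<Rightarrow> ('d, 'm) monoid_scheme \<Rightarrow> ('g, 'n) monoid_scheme \<Rightarrow> ('g \<Rightarrow> 'v \<Rightarrow> 'v)
       \<Rightarrow> (('v \<times> 'd) list set set \<times> 'g) monoid" where
  "graph_wreath_product V E \<Delta> \<Gamma> \<phi> =
     semidirect_product (graph_product V E \<Delta>) \<Gamma> (\<lambda>\<gamma>. relabel (\<phi> \<gamma>))"


section \<open>Basic properties\<close>

subsection \<open>The free product is a group\<close>

lemma words_simps [simp]:
  "[] \<in> free_product_words I G"
  "x # xs \<in> free_product_words I G \<longleftrightarrow>
     fst x \<in> I \<and> snd x \<in> carrier (G (fst x)) \<and> xs \<in> free_product_words I G"
  "xs @ ys \<in> free_product_words I G \<longleftrightarrow>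
     xs \<in> free_product_words I G \<and> ys \<in> free_product_words I G"
  by (simp_all add: free_product_words_def mem_Sigma_iff[of "fst x" "snd x", simplified])

locale group_family =
  fixes I :: "'i set" and G :: "'i \<Rightarrow> ('a, 'm) monoid_scheme"
  assumes factor_group: "i \<in> I \<Longrightarrow> group (G i)"
begin

abbreviation "W \<equiv> free_product_words I G"
abbreviation "R \<equiv> free_product_rel I G"
abbreviation "P \<equiv> free_product I G"

lemma rel_words: "(xs, ys) \<in> R \<Longrightarrow> xs \<in> W \<and> ys \<in> W"
  by (induction rule: free_product_rel.induct)
     (auto simp: factor_group group.is_monoid monoid.m_closed monoid.one_closed)

lemma equiv_rel: "equiv W R"
proof (rule equivI)
  show "R \<subseteq> W \<times> W" using rel_words by auto
  show "refl_on W R" by (auto simp: refl_on_def intro: free_product_rel.refl)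
  show "Relation.sym R" by (meson symI free_product_rel.sym)
  show "Relation.trans R" by (meson transI free_product_rel.trans)
qed

lemma rel_context:
  "(xs, ys) \<in> R \<Longrightarrow> us \<in> W \<Longrightarrow> vs \<in> W \<Longrightarrow> (us @ xs @ vs, us @ ys @ vs) \<in> R"
proof (induction rule: free_product_rel.induct)
  case (unit xs ys i)
  then show ?case using free_product_rel.unit[of "us @ xs" I G "ys @ vs" i] by simp
next
  case (merge xs ys i a b)
  then show ?case using free_product_rel.merge[of "us @ xs" I G "ys @ vs" i a b] by simp
next
  case (trans xs ys zs)
  then show ?case using free_product_rel.trans by blast
qed (auto intro: free_product_rel.refl free_product_rel.sym)

lemma rel_append: "(xs, xs') \<in> R \<Longrightarrow> (ys, ys') \<in> R \<Longrightarrow> (xs @ ys, xs' @ ys') \<in> R"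
  using rel_context[of xs xs' "[]" ys] rel_context[of ys ys' xs' "[]"] rel_words[of xs xs']
    rel_words[of ys ys'] free_product_rel.trans by fastforce

lemma mult_class:
  assumes "xs \<in> W" "ys \<in> W"
  shows "R `` {xs} \<otimes>\<^bsub>P\<^esub> R `` {ys} = R `` {xs @ ys}"
proof -
  have "congruent2 R R (\<lambda>xs ys. R `` {xs @ ys})"
    by (rule congruent2I') (auto intro!: equiv_class_eq[OF equiv_rel] rel_append)
  from UN_equiv_class2[OF equiv_rel equiv_rel this assms] show ?thesis
    by (simp add: free_product_def)
qed

lemma class_in_carrier: "xs \<in> W \<Longrightarrow> R `` {xs} \<in> carrier P"
  by (simp add: free_product_def quotientI)

lemma carrier_cases:
  assumes "A \<in> carrier P" obtains xs where "xs \<in> W" "A = R `` {xs}"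
  using assms by (auto simp: free_product_def elim: quotientE)

lemma one_class: "\<one>\<^bsub>P\<^esub> = R `` {[]}"
  by (simp add: free_product_def)

lemma word_inverse: "xs \<in> W \<Longrightarrow> \<exists>ys\<in>W. (ys @ xs, []) \<in> R"
proof (induction xs)
  case Nil
  then show ?case using free_product_rel.refl[of "[]" I G] by (intro bexI[of _ "[]"]) auto
next
  case (Cons x xs)
  obtain i a where x: "x = (i, a)" by force
  then have ia: "i \<in> I" "a \<in> carrier (G i)" "xs \<in> W" using Cons.prems by auto
  interpret Gi: group "G i" using factor_group ia(1) .
  obtain ys where ys: "ys \<in> W" "(ys @ xs, []) \<in> R" using Cons by auto
  have "(ys @ (i, inv\<^bsub>G i\<^esub> a) # (i, a) # xs, ys @ (i, inv\<^bsub>G i\<^esub> a \<otimes>\<^bsub>G i\<^esub> a) # xs) \<in> R"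
    using ia ys by (intro free_product_rel.merge) auto
  moreover have "(ys @ (i, inv\<^bsub>G i\<^esub> a \<otimes>\<^bsub>G i\<^esub> a) # xs, ys @ xs) \<in> R"
    using ia ys free_product_rel.unit[of ys I G xs i] by simp
  ultimately have "((ys @ [(i, inv\<^bsub>G i\<^esub> a)]) @ x # xs, []) \<in> R"
    using ys(2) x by (auto intro: free_product_rel.trans)
  then show ?case using ia ys by (intro bexI[of _ "ys @ [(i, inv\<^bsub>G i\<^esub> a)]"]) auto
qed

lemma free_product_group: "group P"
proof (rule groupI)
  fix A B assume "A \<in> carrier P" "B \<in> carrier P"
  then show "A \<otimes>\<^bsub>P\<^esub> B \<in> carrier P"
    by (elim carrier_cases) (simp add: mult_class class_in_carrier)
next
  show "\<one>\<^bsub>P\<^esub> \<in> carrier P" by (simp add: one_class class_in_carrier)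
next
  fix A B C assume "A \<in> carrier P" "B \<in> carrier P" "C \<in> carrier P"
  then show "A \<otimes>\<^bsub>P\<^esub> B \<otimes>\<^bsub>P\<^esub> C = A \<otimes>\<^bsub>P\<^esub> (B \<otimes>\<^bsub>P\<^esub> C)"
    by (elim carrier_cases) (simp add: mult_class)
next
  fix A assume "A \<in> carrier P"
  then show "\<one>\<^bsub>P\<^esub> \<otimes>\<^bsub>P\<^esub> A = A"
    by (elim carrier_cases) (simp add: mult_class one_class)
next
  fix A assume "A \<in> carrier P"
  then obtain xs where xs: "xs \<in> W" "A = R `` {xs}" by (rule carrier_cases)
  obtain ys where ys: "ys \<in> W" "(ys @ xs, []) \<in> R" using word_inverse[OF xs(1)] by auto
  show "\<exists>B\<in>carrier P. B \<otimes>\<^bsub>P\<^esub> A = \<one>\<^bsub>P\<^esub>"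
    using xs ys by (intro bexI[of _ "R `` {ys}"])
      (simp_all add: mult_class one_class class_in_carrier equiv_class_eq[OF equiv_rel])
qed

lemma free_product_inj_hom: "i \<in> I \<Longrightarrow> free_product_inj I G i \<in> hom (G i) P"
proof (rule homI)
  fix a assume "i \<in> I" "a \<in> carrier (G i)"
  then show "free_product_inj I G i a \<in> carrier P"
    by (simp add: free_product_inj_def class_in_carrier)
next
  fix a b assume *: "i \<in> I" "a \<in> carrier (G i)" "b \<in> carrier (G i)"
  then have "([(i, a), (i, b)], [(i, a \<otimes>\<^bsub>G i\<^esub> b)]) \<in> R"
    using free_product_rel.merge[of "[]" I G "[]" i a b] by simp
  then show "free_product_inj I G i (a \<otimes>\<^bsub>G i\<^esub> b) =
      free_product_inj I G i a \<otimes>\<^bsub>P\<^esub> free_product_inj I G i b"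
    using * by (simp add: free_product_inj_def mult_class equiv_class_eq[OF equiv_rel])
qed

end


subsection \<open>The graph product is a group\<close>

lemma normal_closure_normal:
  assumes "group G" "S \<subseteq> carrier G"
  shows "normal_closure G S \<lhd> G"
proof -
  interpret group G by fact
  have top: "carrier G \<lhd> G"
    using subgroup_self by (auto simp: normal_inv_iff)
  have sub: "subgroup (normal_closure G S) G"
    unfolding normal_closure_def
    by (rule subgroups_Inter) (use top assms(2) in \<open>auto intro: normal_imp_subgroup\<close>)
  show ?thesis
    unfolding normal_inv_iff using sub
    by (auto simp: normal_closure_def intro: normal.inv_op_closed2)
qed

lemma normal_closure_superset: "S \<subseteq> normal_closure G S"
  by (auto simp: normal_closure_def)

lemma normal_closure_least: "N \<lhd> G \<Longrightarrow> S \<subseteq> N \<Longrightarrow> normal_closure G S \<subseteq> N"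
  by (auto simp: normal_closure_def)

lemma group_family_const: "group \<Delta> \<Longrightarrow> group_family I (\<lambda>_. \<Delta>)"
  by (simp add: group_family_def)

lemma graph_product_commutators_carrier:
  assumes "group \<Delta>"
  shows "graph_product_commutators V E \<Delta> \<subseteq> carrier (free_product V (\<lambda>_. \<Delta>))"
proof -
  interpret group_family V "\<lambda>_. \<Delta>" using assms by (rule group_family_const)
  interpret P: group P by (rule free_product_group)
  have "free_product_inj V (\<lambda>_. \<Delta>) v a \<in> carrier P" if "v \<in> V" "a \<in> carrier \<Delta>" for v a
    using free_product_inj_hom[OF that(1)] that(2) by (auto simp: hom_def)
  then show ?thesis by (auto simp: graph_product_commutators_def Let_def)
qed

lemma graph_product_kernel_normal:
  assumes "group \<Delta>"
  shows "graph_product_kernel V E \<Delta> \<lhd> free_product V (\<lambda>_. \<Delta>)"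
  using normal_closure_normal[OF group_family.free_product_group[OF group_family_const[OF assms]]
    graph_product_commutators_carrier[OF assms]] .

lemma graph_product_group: "group \<Delta> \<Longrightarrow> group (graph_product V E \<Delta>)"
  unfolding graph_product_def by (rule normal.factorgroup_is_group[OF graph_product_kernel_normal])


subsection \<open>The action on the graph product\<close>

locale graph_wreath =
  simplicial_graph V E + \<Delta>: group \<Delta> + group_action \<Gamma> V \<phi>
  for V :: "'v set" and E and \<Delta> :: "('d, 'm) monoid_scheme"
    and \<Gamma> :: "('g, 'n) monoid_scheme" and \<phi> +
  assumes automorphism: "\<gamma> \<in> carrier \<Gamma> \<Longrightarrow> graph_automorphism V E (\<phi> \<gamma>)"
begin

sublocale group_family V "\<lambda>_. \<Delta>"
  by (rule group_family_const) (rule \<Delta>.is_group)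

sublocale P: group P
  by (rule free_product_group)

sublocale \<Gamma>: group \<Gamma>
  using group_hom by (simp add: group_hom_def)

abbreviation "N \<equiv> graph_product_kernel V E \<Delta>"
abbreviation "ren \<gamma> \<equiv> (map (apfst (\<phi> \<gamma>)) :: ('v \<times> 'd) list \<Rightarrow> _)"

sublocale N: normal N P
  by (rule graph_product_kernel_normal) (rule \<Delta>.is_group)

lemma \<phi>_closed: "\<gamma> \<in> carrier \<Gamma> \<Longrightarrow> v \<in> V \<Longrightarrow> \<phi> \<gamma> v \<in> V"
  by (simp add: element_image)

lemma ren_words: "\<gamma> \<in> carrier \<Gamma> \<Longrightarrow> xs \<in> W \<Longrightarrow> ren \<gamma> xs \<in> W"
  by (induction xs) (auto simp: \<phi>_closed)

lemma ren_mult: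
  "\<gamma> \<in> carrier \<Gamma> \<Longrightarrow> \<gamma>' \<in> carrier \<Gamma> \<Longrightarrow> xs \<in> W \<Longrightarrow> ren (\<gamma> \<otimes>\<^bsub>\<Gamma>\<^esub> \<gamma>') xs = ren \<gamma> (ren \<gamma>' xs)"
  by (induction xs) (auto simp: composition_rule)

lemma ren_one: "xs \<in> W \<Longrightarrow> ren \<one>\<^bsub>\<Gamma>\<^esub> xs = xs"
  by (induction xs) (auto simp: id_eq_one[symmetric])

lemma ren_inv:
  assumes "\<gamma> \<in> carrier \<Gamma>" "xs \<in> W"
  shows "ren \<gamma> (ren (inv\<^bsub>\<Gamma>\<^esub> \<gamma>) xs) = xs"
  using assms ren_mult[of \<gamma> "inv\<^bsub>\<Gamma>\<^esub> \<gamma>" xs] by (simp add: ren_one)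

lemma ren_rel: "(xs, ys) \<in> R \<Longrightarrow> \<gamma> \<in> carrier \<Gamma> \<Longrightarrow> (ren \<gamma> xs, ren \<gamma> ys) \<in> R"
proof (induction rule: free_product_rel.induct)
  case (unit xs ys i)
  then show ?case
    using free_product_rel.unit[of "ren \<gamma> xs" V "\<lambda>_. \<Delta>" "ren \<gamma> ys" "\<phi> \<gamma> i"]
    by (simp add: ren_words \<phi>_closed)
next
  case (merge xs ys i a b)
  then show ?case
    using free_product_rel.merge[of "ren \<gamma> xs" V "\<lambda>_. \<Delta>" "ren \<gamma> ys" "\<phi> \<gamma> i" a b]
    by (simp add: ren_words \<phi>_closed)
next
  case (trans xs ys zs)
  then show ?case using free_product_rel.trans by blast
qed (auto intro: free_product_rel.refl free_product_rel.sym ren_words)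

lemma ren_class:
  assumes "\<gamma> \<in> carrier \<Gamma>" "xs \<in> W"
  shows "ren \<gamma> ` (R `` {xs}) = R `` {ren \<gamma> xs}"
proof
  show "ren \<gamma> ` (R `` {xs}) \<subseteq> R `` {ren \<gamma> xs}" using ren_rel assms by auto
  show "R `` {ren \<gamma> xs} \<subseteq> ren \<gamma> ` (R `` {xs})"
  proof
    fix ys assume "ys \<in> R `` {ren \<gamma> xs}"
    then have r: "(ren \<gamma> xs, ys) \<in> R" by simp
    then have ys: "ys \<in> W" using rel_words by blast
    have "ren (inv\<^bsub>\<Gamma>\<^esub> \<gamma>) (ren \<gamma> xs) = xs"
      using assms ren_inv[of "inv\<^bsub>\<Gamma>\<^esub> \<gamma>" xs] by simp
    then have "(xs, ren (inv\<^bsub>\<Gamma>\<^esub> \<gamma>) ys) \<in> R"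
      using ren_rel[OF r, of "inv\<^bsub>\<Gamma>\<^esub> \<gamma>"] assms by simp
    moreover have "ys = ren \<gamma> (ren (inv\<^bsub>\<Gamma>\<^esub> \<gamma>) ys)" using ren_inv assms ys by simp
    ultimately show "ys \<in> ren \<gamma> ` (R `` {xs})" by blast
  qed
qed

lemma ren_free_product_inj:
  "\<gamma> \<in> carrier \<Gamma> \<Longrightarrow> v \<in> V \<Longrightarrow> g \<in> carrier \<Delta> \<Longrightarrow>
     ren \<gamma> ` free_product_inj V (\<lambda>_. \<Delta>) v g = free_product_inj V (\<lambda>_. \<Delta>) (\<phi> \<gamma> v) g"
  by (simp add: free_product_inj_def ren_class)

lemma ren_hom: "\<gamma> \<in> carrier \<Gamma> \<Longrightarrow> (`) (ren \<gamma>) \<in> hom P P"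
proof (rule homI)
  fix A assume "\<gamma> \<in> carrier \<Gamma>" "A \<in> carrier P"
  then show "ren \<gamma> ` A \<in> carrier P"
    by (elim carrier_cases) (simp add: ren_class class_in_carrier ren_words)
next
  fix A B assume "\<gamma> \<in> carrier \<Gamma>" "A \<in> carrier P" "B \<in> carrier P"
  then show "ren \<gamma> ` (A \<otimes>\<^bsub>P\<^esub> B) = ren \<gamma> ` A \<otimes>\<^bsub>P\<^esub> ren \<gamma> ` B"
    by (elim carrier_cases) (simp add: ren_class mult_class ren_words)
qed

lemma ren_class_mult:
  "\<gamma> \<in> carrier \<Gamma> \<Longrightarrow> \<gamma>' \<in> carrier \<Gamma> \<Longrightarrow> A \<in> carrier P \<Longrightarrow>
     ren (\<gamma> \<otimes>\<^bsub>\<Gamma>\<^esub> \<gamma>') ` A = ren \<gamma> ` ren \<gamma>' ` A"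
  by (elim carrier_cases) (simp add: ren_class ren_words ren_mult)

lemma ren_class_one: "A \<in> carrier P \<Longrightarrow> ren \<one>\<^bsub>\<Gamma>\<^esub> ` A = A"
  by (elim carrier_cases) (simp add: ren_class ren_one)

lemma inj_carrier: "v \<in> V \<Longrightarrow> g \<in> carrier \<Delta> \<Longrightarrow> free_product_inj V (\<lambda>_. \<Delta>) v g \<in> carrier P"
  using free_product_inj_hom by (auto simp: hom_def)

lemma ren_kernel_subset:
  assumes "\<gamma> \<in> carrier \<Gamma>" "A \<in> N"
  shows "ren \<gamma> ` A \<in> N"
proof -
  interpret h: group_hom P P "(`) (ren \<gamma>)"
    using ren_hom[OF assms(1)] by unfold_locales
  let ?M = "{A \<in> carrier P. ren \<gamma> ` A \<in> N}"
  have "subgroup ?M P"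
    by (rule P.subgroupI) (use h.hom_one h.hom_inv h.hom_mult h.hom_closed in
        \<open>auto simp: N.m_closed N.m_inv_closed intro!: exI[of _ "\<one>\<^bsub>P\<^esub>"] simp del: image_eqI\<close>)
  then have "?M \<lhd> P"
    unfolding P.normal_inv_iff
    using h.hom_inv h.hom_mult h.hom_closed by (auto simp: N.inv_op_closed2)
  moreover have "graph_product_commutators V E \<Delta> \<subseteq> ?M"
  proof
    fix c assume c: "c \<in> graph_product_commutators V E \<Delta>"
    let ?\<iota> = "free_product_inj V (\<lambda>_. \<Delta>)"
    obtain v w a b where vw: "v \<in> V" "w \<in> V" "{v, w} \<in> E" "a \<in> carrier \<Delta>" "b \<in> carrier \<Delta>"
      and c_eq: "c = ?\<iota> v a \<otimes>\<^bsub>P\<^esub> ?\<iota> w b \<otimes>\<^bsub>P\<^esub> inv\<^bsub>P\<^esub> (?\<iota> v a) \<otimes>\<^bsub>P\<^esub> inv\<^bsub>P\<^esub> (?\<iota> w b)"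
      using c by (auto simp: graph_product_commutators_def Let_def)
    have e: "{\<phi> \<gamma> v, \<phi> \<gamma> w} \<in> E" "\<phi> \<gamma> v \<in> V" "\<phi> \<gamma> w \<in> V"
      using automorphism[OF assms(1)] vw \<phi>_closed[OF assms(1)]
      by (auto simp: graph_automorphism_def)
    have "ren \<gamma> ` c = ?\<iota> (\<phi> \<gamma> v) a \<otimes>\<^bsub>P\<^esub> ?\<iota> (\<phi> \<gamma> w) b \<otimes>\<^bsub>P\<^esub> inv\<^bsub>P\<^esub> (?\<iota> (\<phi> \<gamma> v) a)
        \<otimes>\<^bsub>P\<^esub> inv\<^bsub>P\<^esub> (?\<iota> (\<phi> \<gamma> w) b)"
      using vw assms(1) by (simp add: c_eq inj_carrier ren_free_product_inj)
    then have "ren \<gamma> ` c \<in> graph_product_commutators V E \<Delta>"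
      using e vw(4,5) unfolding graph_product_commutators_def Let_def by blast
    then show "c \<in> ?M"
      using subsetD[OF graph_product_commutators_carrier[OF \<Delta>.is_group] c]
      by (simp add: subsetD[OF normal_closure_superset])
  qed
  ultimately have "N \<subseteq> ?M" by (rule normal_closure_least)
  then show ?thesis using assms(2) by auto
qed

lemma relabel_coset:
  assumes "\<gamma> \<in> carrier \<Gamma>" "A \<in> carrier P"
  shows "relabel (\<phi> \<gamma>) (N #>\<^bsub>P\<^esub> A) = N #>\<^bsub>P\<^esub> (ren \<gamma> ` A)"
proof -
  interpret h: group_hom P P "(`) (ren \<gamma>)"
    using ren_hom[OF assms(1)] by unfold_locales
  have sub: "B \<in> carrier P" if "B \<in> N" for B using that N.subset by blast
  have "B \<in> (`) (ren \<gamma>) ` N" if "B \<in> N" for B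
  proof -
    have "B = ren \<gamma> ` ren (inv\<^bsub>\<Gamma>\<^esub> \<gamma>) ` B"
      using ren_class_mult[of \<gamma> "inv\<^bsub>\<Gamma>\<^esub> \<gamma>" B] assms(1) sub[OF that] by (simp add: ren_class_one)
    then show ?thesis using ren_kernel_subset[of "inv\<^bsub>\<Gamma>\<^esub> \<gamma>" B] assms(1) that by auto
  qed
  then have N: "(`) (ren \<gamma>) ` N = N" using ren_kernel_subset[OF assms(1)] by blast
  have "relabel (\<phi> \<gamma>) (N #>\<^bsub>P\<^esub> A) = (\<lambda>B. ren \<gamma> ` (B \<otimes>\<^bsub>P\<^esub> A)) ` N"
    by (auto simp: relabel_def r_coset_def)
  also have "\<dots> = (\<lambda>B. ren \<gamma> ` B \<otimes>\<^bsub>P\<^esub> ren \<gamma> ` A) ` N"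
    using sub assms(2) by (intro image_cong) auto
  also have "\<dots> = (\<lambda>B. B \<otimes>\<^bsub>P\<^esub> ren \<gamma> ` A) ` ((`) (ren \<gamma>) ` N)" by (simp add: image_image)
  also have "\<dots> = N #>\<^bsub>P\<^esub> (ren \<gamma> ` A)" unfolding N by (auto simp: r_coset_def)
  finally show ?thesis .
qed

lemma relabel_graph_product_inj:
  "\<gamma> \<in> carrier \<Gamma> \<Longrightarrow> v \<in> V \<Longrightarrow> g \<in> carrier \<Delta> \<Longrightarrow>
     relabel (\<phi> \<gamma>) (graph_product_inj V E \<Delta> v g) = graph_product_inj V E \<Delta> (\<phi> \<gamma> v) g"
  by (simp add: graph_product_inj_def relabel_coset inj_carrier ren_free_product_inj)

lemma graph_product_cases:
  assumes "X \<in> carrier (graph_product V E \<Delta>)"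
  obtains A where "A \<in> carrier P" "X = N #>\<^bsub>P\<^esub> A"
  using assms by (auto simp: graph_product_def FactGroup_def RCOSETS_def)

lemma relabel_hom:
  assumes "\<gamma> \<in> carrier \<Gamma>"
  shows "relabel (\<phi> \<gamma>) \<in> hom (graph_product V E \<Delta>) (graph_product V E \<Delta>)"
proof -
  have closed: "ren \<gamma> ` A \<in> carrier P" if "A \<in> carrier P" for A
    using ren_hom[OF assms] that by (auto simp: hom_def)
  have mult: "ren \<gamma> ` (A \<otimes>\<^bsub>P\<^esub> B) = ren \<gamma> ` A \<otimes>\<^bsub>P\<^esub> ren \<gamma> ` B" if "A \<in> carrier P" "B \<in> carrier P" for A B
    using ren_hom[OF assms] that by (auto simp: hom_def)
  show ?thesis
    by (rule homI; elim graph_product_cases)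
       (use assms in \<open>auto simp: relabel_coset closed mult graph_product_def FactGroup_def N.rcos_sum
          intro!: P.rcosetsI N.subset\<close>)
qed

lemma relabel_mult:
  "\<gamma> \<in> carrier \<Gamma> \<Longrightarrow> \<gamma>' \<in> carrier \<Gamma> \<Longrightarrow> X \<in> carrier (graph_product V E \<Delta>) \<Longrightarrow>
     relabel (\<phi> (\<gamma> \<otimes>\<^bsub>\<Gamma>\<^esub> \<gamma>')) X = relabel (\<phi> \<gamma>) (relabel (\<phi> \<gamma>') X)"
  using ren_hom[of \<gamma>']
  by (elim graph_product_cases) (simp add: relabel_coset ren_class_mult hom_def Pi_iff)

lemma relabel_one:
  "X \<in> carrier (graph_product V E \<Delta>) \<Longrightarrow> relabel (\<phi> \<one>\<^bsub>\<Gamma>\<^esub>) X = X"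
  by (elim graph_product_cases) (auto simp: relabel_coset ren_class_one)

lemma relabel_bij:
  assumes "\<gamma> \<in> carrier \<Gamma>"
  shows "bij_betw (relabel (\<phi> \<gamma>)) (carrier (graph_product V E \<Delta>)) (carrier (graph_product V E \<Delta>))"
proof (rule bij_betw_byWitness[where f' = "relabel (\<phi> (inv\<^bsub>\<Gamma>\<^esub> \<gamma>))"])
  show "\<forall>X\<in>carrier (graph_product V E \<Delta>). relabel (\<phi> (inv\<^bsub>\<Gamma>\<^esub> \<gamma>)) (relabel (\<phi> \<gamma>) X) = X"
    "\<forall>X\<in>carrier (graph_product V E \<Delta>). relabel (\<phi> \<gamma>) (relabel (\<phi> (inv\<^bsub>\<Gamma>\<^esub> \<gamma>)) X) = X"
    using assms by (simp_all flip: relabel_mult add: relabel_one)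
qed (use relabel_hom[OF assms] relabel_hom[of "inv\<^bsub>\<Gamma>\<^esub> \<gamma>"] assms in \<open>auto simp: hom_def\<close>)

lemma relabel_in_AutoGroup:
  "(\<lambda>\<gamma>. restrict (relabel (\<phi> \<gamma>)) (carrier (graph_product V E \<Delta>)))
     \<in> hom \<Gamma> (AutoGroup (graph_product V E \<Delta>))" (is "?r \<in> _")
proof -
  let ?G = "graph_product V E \<Delta>"
  interpret G: group ?G by (rule graph_product_group) (rule \<Delta>.is_group)
  have Bij: "?r \<gamma> \<in> Bij (carrier ?G)" if "\<gamma> \<in> carrier \<Gamma>" for \<gamma>
    using relabel_bij[OF that] by (simp add: Bij_def cong: bij_betw_cong)
  have closed: "relabel (\<phi> \<gamma>) X \<in> carrier ?G" if "\<gamma> \<in> carrier \<Gamma>" "X \<in> carrier ?G" for \<gamma> X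
    using relabel_hom[OF that(1)] that(2) by (auto simp: hom_def)
  have hom: "?r \<gamma> \<in> hom ?G ?G" if "\<gamma> \<in> carrier \<Gamma>" for \<gamma>
    using relabel_hom[OF that] by (auto simp: hom_def)
  show ?thesis
  proof (rule homI)
    fix \<gamma> assume "\<gamma> \<in> carrier \<Gamma>"
    then show "?r \<gamma> \<in> carrier (AutoGroup ?G)" by (simp add: AutoGroup_def auto_def Bij hom)
  next
    fix \<gamma> \<gamma>' assume "\<gamma> \<in> carrier \<Gamma>" "\<gamma>' \<in> carrier \<Gamma>"
    then show "?r (\<gamma> \<otimes>\<^bsub>\<Gamma>\<^esub> \<gamma>') = ?r \<gamma> \<otimes>\<^bsub>AutoGroup ?G\<^esub> ?r \<gamma>'"
      using Bij[of \<gamma>] Bij[of \<gamma>']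
      by (simp add: AutoGroup_def BijGroup_def compose_def relabel_mult closed cong: restrict_cong)
  qed
qed

lemma graph_wreath_product_group: "group (graph_wreath_product V E \<Delta> \<Gamma> \<phi>)"
proof -
  let ?G = "graph_product V E \<Delta>"
  interpret G: group ?G by (rule graph_product_group) (rule \<Delta>.is_group)
  have closed: "relabel (\<phi> \<gamma>) X \<in> carrier ?G" if "\<gamma> \<in> carrier \<Gamma>" "X \<in> carrier ?G" for \<gamma> X
    using relabel_hom[OF that(1)] that(2) by (auto simp: hom_def)
  have mult: "relabel (\<phi> \<gamma>) (X \<otimes>\<^bsub>?G\<^esub> Y) = relabel (\<phi> \<gamma>) X \<otimes>\<^bsub>?G\<^esub> relabel (\<phi> \<gamma>) Y"
    if "\<gamma> \<in> carrier \<Gamma>" "X \<in> carrier ?G" "Y \<in> carrier ?G" for \<gamma> X Y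
    using relabel_hom[OF that(1)] that(2,3) by (auto simp: hom_def)
  show ?thesis
    unfolding graph_wreath_product_def semidirect_product_def
  proof (rule groupI, goal_cases)
    case (5 x)
    obtain X \<gamma> where x: "x = (X, \<gamma>)" "X \<in> carrier ?G" "\<gamma> \<in> carrier \<Gamma>" using 5 by auto
    let ?Y = "relabel (\<phi> (inv\<^bsub>\<Gamma>\<^esub> \<gamma>)) (inv\<^bsub>?G\<^esub> X)"
    have "?Y \<otimes>\<^bsub>?G\<^esub> relabel (\<phi> (inv\<^bsub>\<Gamma>\<^esub> \<gamma>)) X = relabel (\<phi> (inv\<^bsub>\<Gamma>\<^esub> \<gamma>)) \<one>\<^bsub>?G\<^esub>"
      using x by (simp flip: mult)
    also have "\<dots> = \<one>\<^bsub>?G\<^esub>"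
      using hom_one[OF relabel_hom G.is_group G.is_group] x by simp
    finally show ?case
      using x closed by (intro bexI[of _ "(?Y, inv\<^bsub>\<Gamma>\<^esub> \<gamma>)"]) auto
  qed (auto simp: closed mult relabel_mult relabel_one G.m_assoc \<Gamma>.m_assoc)
qed

end

end

theory Submission
  imports Defs
begin

text \<open>
  Let \<open>ws\<close> be a reduced word with letters \<open>(v\<^sub>i, g\<^sub>i)\<close>, \<open>i < n\<close>, and let \<open>f : \<Delta> \<rightarrow> F\<close> and
  \<open>\<kappa> : \<Gamma> \<rightarrow> Q\<close> be homomorphisms such that no \<open>f g\<^sub>i\<close> is trivial and the vertices \<open>v\<^sub>i\<close> still span the
  same graph modulo the kernel of \<open>\<kappa>\<close>.  The graph wreath product acts on \<open>F\<^sup>n \<times> Q\<close>: the group \<open>\<Gamma>\<close>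
  translates \<open>Q\<close>, and \<open>a\<^sub>(\<^sub>u\<^sub>)\<close> multiplies the coordinate \<open>x\<^sub>i\<close> of \<open>(x, q)\<close> by \<open>f a\<close> if
  \<open>u \<in> \<kappa>\<^sup>-\<^sup>1(q) v\<^sub>i\<close> and the coordinates \<open>x\<^sub>j\<close> at vertices \<open>v\<^sub>j\<close> neither equal nor adjacent to \<open>v\<^sub>i\<close>
  say that, reading \<open>ws\<close> from the right, it is the turn of letter \<open>i\<close>.  Adjacent vertices do not read
  each other's coordinates, so their actions commute; reducedness of \<open>ws\<close> makes exactly one
  coordinate move at each letter, so \<open>ws\<close> moves \<open>((1, \<dots>, 1), 1)\<close> to \<open>((f g\<^sub>0, \<dots>, f g\<^sub>n\<^sub>-\<^sub>1), 1)\<close>.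
  With \<open>F\<close> and \<open>Q\<close> finite this separates \<open>ws\<close> from the identity; with identity maps \<open>f\<close> and \<open>\<kappa>\<close> it
  is the normal form theorem for graph products.

  Conversely, if \<open>k \<in> \<Gamma>\<close> dies in a finite quotient, then \<open>a\<^sub>(\<^sub>v\<^sub>)\<close> and \<open>a\<^sub>(\<^sub>k\<^sub>v\<^sub>)\<close> have the same
  image there, so a quotient in which \<open>a\<^sub>(\<^sub>v\<^sub>) a\<^sub>(\<^sub>w\<^sub>)\<^sup>-\<^sup>1\<close>, \<open>[a, b]\<^sub>(\<^sub>v\<^sub>)\<close> or
  \<open>[a\<^sub>(\<^sub>v\<^sub>), a\<^sub>(\<^sub>w\<^sub>)]\<close> survives yields the required subgroup.
\<close>

section \<open>Finite quotients\<close>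

text \<open>One finite quotient has to detect all of \<open>S\<close> at once. The set may be
  infinite: complements of finite index subgroups are separated too, so residual finiteness and the
  conditions on orbits take the same form and can be combined.\<close>

definition finitely_separated :: "('a, 'm) monoid_scheme \<Rightarrow> 'a set \<Rightarrow> bool" where
  "finitely_separated G S \<longleftrightarrow>
     (\<exists>(H :: nat monoid) h. group H \<and> finite (carrier H) \<and> h \<in> hom G H \<and> (\<forall>x\<in>S. h x \<noteq> \<one>\<^bsub>H\<^esub>))"

lemma residually_finite_iff_separated:
  "residually_finite G \<longleftrightarrow> (\<forall>x\<in>carrier G. x \<noteq> \<one>\<^bsub>G\<^esub> \<longrightarrow> finitely_separated G {x})"
  by (simp add: residually_finite_def finitely_separated_def)

text \<open>Frees the constructions below from the natural numbers: the finite target may have any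
  type, in particular that of permutations of a set of functions.\<close>

lemma finitely_separatedI:
  fixes H :: "'b monoid"
  assumes "group H" "finite (carrier H)" "h \<in> hom G H"
    and "\<And>x. x \<in> S \<Longrightarrow> x \<in> carrier G \<and> h x \<noteq> \<one>\<^bsub>H\<^esub>"
  shows "finitely_separated G S"
proof -
  obtain H' :: "nat monoid" and f where H': "group H'" "finite (carrier H')" and f: "f \<in> iso H H'"
    using finite_group_nat_copy[OF assms(1,2)] by metis
  then have fh: "f \<in> hom H H'" and inj: "inj_on f (carrier H)"
    by (auto simp: iso_def bij_betw_def)
  have "f (h x) \<noteq> \<one>\<^bsub>H'\<^esub>" if "x \<in> S" for x
  proof -
    have "h x \<in> carrier H" using assms(3) assms(4)[OF that] by (auto simp: hom_def)
    then have "f (h x) \<noteq> f \<one>\<^bsub>H\<^esub>"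
      using inj_onD[OF inj] assms(4)[OF that] group.is_monoid[OF assms(1)] monoid.one_closed by metis
    then show ?thesis by (simp add: hom_one[OF fh assms(1) H'(1)])
  qed
  then show ?thesis
    unfolding finitely_separated_def using H' hom_compose[OF assms(3) fh]
    by (intro exI[of _ H'] exI[of _ "f \<circ> h"]) auto
qed

lemma finitely_separated_mono: "finitely_separated G T \<Longrightarrow> S \<subseteq> T \<Longrightarrow> finitely_separated G S"
  unfolding finitely_separated_def by blast

lemma finitely_separated_empty: "finitely_separated G {}"
proof -
  have "group (\<lparr>carrier = {0}, monoid.mult = (\<lambda>_ _. 0), one = 0\<rparr> :: nat monoid)"
    by (rule groupI) auto
  then show ?thesis
    by (rule finitely_separatedI[where h = "\<lambda>_. 0"]) (auto simp: hom_def)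
qed

text \<open>The pair of a quotient detecting \<open>S\<close> and one detecting \<open>T\<close>
  maps into the direct product, which detects both.\<close>

lemma finitely_separated_Un:
  assumes "finitely_separated G S" "finitely_separated G T" "S \<subseteq> carrier G" "T \<subseteq> carrier G"
  shows "finitely_separated G (S \<union> T)"
proof -
  obtain H :: "nat monoid" and h where H: "group H" "finite (carrier H)" "h \<in> hom G H"
    "\<forall>x\<in>S. h x \<noteq> \<one>\<^bsub>H\<^esub>" using assms(1) unfolding finitely_separated_def by blast
  obtain H' :: "nat monoid" and h' where H': "group H'" "finite (carrier H')" "h' \<in> hom G H'"
    "\<forall>x\<in>T. h' x \<noteq> \<one>\<^bsub>H'\<^esub>" using assms(2) unfolding finitely_separated_def by blast
  show ?thesis
    by (rule finitely_separatedI[OF DirProd_group[OF H(1) H'(1)], where h = "\<lambda>x. (h x, h' x)"])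
       (use H H' assms(3,4) in \<open>auto simp: hom_def\<close>)
qed

lemma finitely_separated_UN:
  assumes "finite A" "\<And>a. a \<in> A \<Longrightarrow> finitely_separated G (S a) \<and> S a \<subseteq> carrier G"
  shows "finitely_separated G (\<Union>a\<in>A. S a)"
  using assms
proof (induction A)
  case (insert a A)
  then show ?case
    using finitely_separated_Un[of G "S a" "\<Union>a\<in>A. S a"] by auto
qed (simp add: finitely_separated_empty)

lemma residually_finite_inj_hom:
  assumes "residually_finite G" "group G" "group G'" "h \<in> hom G' G"
    and "\<And>x. x \<in> carrier G' \<Longrightarrow> x \<noteq> \<one>\<^bsub>G'\<^esub> \<Longrightarrow> h x \<noteq> \<one>\<^bsub>G\<^esub>"
  shows "residually_finite G'"
  unfolding residually_finite_def
proof (intro ballI impI)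
  fix x assume x: "x \<in> carrier G'" "x \<noteq> \<one>\<^bsub>G'\<^esub>"
  have "h x \<in> carrier G" using assms(4) x by (auto simp: hom_def)
  then obtain H :: "nat monoid" and f where
    "group H" "finite (carrier H)" "f \<in> hom G H" "f (h x) \<noteq> \<one>\<^bsub>H\<^esub>"
    using assms(1) assms(5)[OF x] unfolding residually_finite_def by blast
  then show "\<exists>(H :: nat monoid) h. group H \<and> finite (carrier H) \<and> h \<in> hom G' H \<and> h x \<noteq> \<one>\<^bsub>H\<^esub>"
    using hom_compose[OF assms(4)] by (metis comp_apply)
qed

text \<open>By the first isomorphism theorem the cosets of the kernel inject into the finite group
  \<open>H\<close>.\<close>

lemma finite_index_kernel:
  assumes "group G" "group H" "finite (carrier H)" "h \<in> hom G H"
  shows "finite_index_subgroup G (kernel G H h)"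
proof -
  interpret h: group_hom G H h
    using assms by (simp add: group_hom_def group_hom_axioms_def)
  let ?f = "\<lambda>X. the_elem (h ` X)" and ?Q = "carrier (G Mod kernel G H h)"
  have "finite ?Q"
  proof (rule inj_on_finite[OF _ _ assms(3)])
    show "inj_on ?f ?Q" by (rule h.FactGroup_inj_on)
    show "?f ` ?Q \<subseteq> carrier H" using h.FactGroup_the_elem_mem by blast
  qed
  then show ?thesis
    by (simp add: finite_index_subgroup_def h.subgroup_kernel FactGroup_def)
qed

section \<open>Permutation representations\<close>

lemma hom_BijGroupI:
  fixes G (structure)
  assumes "group G"
    and closed: "\<And>g s. g \<in> carrier G \<Longrightarrow> s \<in> S \<Longrightarrow> a g s \<in> S"
    and mult: "\<And>g h s. g \<in> carrier G \<Longrightarrow> h \<in> carrier G \<Longrightarrow> s \<in> S \<Longrightarrow> a (g \<otimes>\<^bsub>G\<^esub> h) s = a g (a h s)"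
    and one: "\<And>s. s \<in> S \<Longrightarrow> a \<one>\<^bsub>G\<^esub> s = s"
  shows "(\<lambda>g. restrict (a g) S) \<in> hom G (BijGroup S)"
proof -
  interpret group G by fact
  \<comment> \<open>The action of \<open>inv g\<close> inverts that of \<open>g\<close>. The
    restriction is there because elements of \<open>BijGroup S\<close> are extensional.\<close>
  have Bij: "restrict (a g) S \<in> Bij S" if "g \<in> carrier G" for g
  proof -
    have "bij_betw (a g) S S"
      by (rule bij_betw_byWitness[where f' = "a (inv g)"])
         (use that closed in \<open>auto simp: one simp flip: mult\<close>)
    then show ?thesis by (simp add: Bij_def cong: bij_betw_cong)
  qed
  show ?thesis
    by (rule homI) (auto simp: BijGroup_def Bij compose_def mult closed cong: restrict_cong)
qed

lemma BijGroup_mult_apply: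
  "p \<in> carrier (BijGroup S) \<Longrightarrow> q \<in> carrier (BijGroup S) \<Longrightarrow> s \<in> S \<Longrightarrow>
     (p \<otimes>\<^bsub>BijGroup S\<^esub> q) s = p (q s)"
  by (simp add: BijGroup_def compose_def)

lemma BijGroup_eqI:
  assumes "p \<in> carrier (BijGroup S)" "q \<in> carrier (BijGroup S)" "\<And>s. s \<in> S \<Longrightarrow> p s = q s"
  shows "p = q"
  using assms by (intro extensionalityI[of p S q]) (auto simp: BijGroup_def Bij_def)

lemma finite_BijGroup: "finite S \<Longrightarrow> finite (carrier (BijGroup S))"
  using finite_PiE[of S "\<lambda>_. S"]
  by (auto simp: BijGroup_def Bij_def bij_betw_def PiE_def elim!: rev_finite_subset)

text \<open>The group permutes the finitely many right cosets of \<open>K\<close>; multiplying by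
  the inverse on the right makes this a left action. The stabiliser of the coset \<open>K\<close> is
  \<open>K\<close> itself, so every element outside \<open>K\<close> acts nontrivially.\<close>

lemma finitely_separated_finite_index:
  fixes G (structure)
  assumes "group G" "finite_index_subgroup G K"
  shows "finitely_separated G (carrier G - K)"
proof -
  interpret group G by fact
  have K: "subgroup K G" and fin: "finite (rcosets K)"
    using assms(2) by (auto simp: finite_index_subgroup_def)
  interpret K: subgroup K G by fact
  let ?a = "\<lambda>g A. A #> inv g" and ?S = "rcosets K"
  have sub: "A \<subseteq> carrier G" if "A \<in> ?S" for A
    using that rcosets_part_G[OF K] by blast
  have "(\<lambda>g. restrict (?a g) ?S) \<in> hom G (BijGroup ?S)"
  proof (rule hom_BijGroupI[OF \<open>group G\<close>])
    fix g A assume "g \<in> carrier G" "A \<in> ?S"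
    then show "A #> inv g \<in> ?S"
      by (auto simp: RCOSETS_def coset_mult_assoc K.subset intro!: bexI[of _ "_ \<otimes> inv g"])
  qed (auto simp: coset_mult_assoc inv_mult_group sub)
  moreover have "restrict (?a g) ?S \<noteq> \<one>\<^bsub>BijGroup ?S\<^esub>" if "g \<in> carrier G - K" for g
  proof
    assume eq: "restrict (?a g) ?S = \<one>\<^bsub>BijGroup ?S\<^esub>"
    have KS: "K \<in> ?S" by (simp add: K.subgroup_in_rcosets is_group)
    then have "K #> inv g = \<one>\<^bsub>BijGroup ?S\<^esub> K" by (simp flip: eq)
    also have "\<dots> = K" using KS by (simp add: BijGroup_def)
    finally have "K #> inv g = K" .
    then have "inv g \<in> K" using coset_join1[OF _ _ K] that by auto
    then have "inv (inv g) \<in> K" by blast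
    then show False using that by simp
  qed
  ultimately show ?thesis
    by (intro finitely_separatedI[OF group_BijGroup finite_BijGroup[OF fin]]) auto
qed


section \<open>Words in graph products\<close>

definition word_class ::
    "'v set \<Rightarrow> 'v set set \<Rightarrow> ('d, 'm) monoid_scheme \<Rightarrow> ('v \<times> 'd) list \<Rightarrow> ('v \<times> 'd) list set set" where
  "word_class V E \<Delta> xs = graph_product_kernel V E \<Delta> #>\<^bsub>free_product V (\<lambda>_. \<Delta>)\<^esub>
     (free_product_rel V (\<lambda>_. \<Delta>) `` {xs})"

definition word_eval :: "('h, 'k) monoid_scheme \<Rightarrow> ('v \<Rightarrow> 'd \<Rightarrow> 'h) \<Rightarrow> ('v \<times> 'd) list \<Rightarrow> 'h" where
  "word_eval H h xs = foldr (\<lambda>(v, a). (\<otimes>\<^bsub>H\<^esub>) (h v a)) xs \<one>\<^bsub>H\<^esub>"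

text \<open>Two letters at the same vertex must be kept apart by a letter that neither can be
  swapped past. The clause \<open>w \<noteq> v\<close> matters: without loops, a further letter at
  \<open>v\<close> would otherwise count as such an obstacle.\<close>

definition reduced_word ::
    "'v set set \<Rightarrow> ('d, 'm) monoid_scheme \<Rightarrow> ('v \<times> 'd) list \<Rightarrow> bool" where
  "reduced_word E \<Delta> xs \<longleftrightarrow>
     (\<forall>x\<in>set xs. snd x \<noteq> \<one>\<^bsub>\<Delta>\<^esub>) \<and>
     (\<forall>as v a bs b cs. xs = as @ (v, a) # bs @ (v, b) # cs \<longrightarrow>
        (\<exists>w\<in>fst ` set bs. w \<noteq> v \<and> {v, w} \<notin> E))"

lemma reduced_word_between:
  assumes "reduced_word E \<Delta> ws" "a < b" "b < length ws" "fst (ws ! a) = fst (ws ! b)"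
  shows "\<exists>j. a < j \<and> j < b \<and> fst (ws ! j) \<noteq> fst (ws ! a) \<and> {fst (ws ! a), fst (ws ! j)} \<notin> E"
proof -
  let ?us = "take (b - Suc a) (drop (Suc a) ws)"
  have "ws = take a ws @ ws ! a # drop (Suc a) ws"
    using assms by (simp add: id_take_nth_drop)
  also have "drop (Suc a) ws = ?us @ drop (Suc a) ws ! (b - Suc a) # drop (Suc (b - Suc a)) (drop (Suc a) ws)"
    using assms by (intro id_take_nth_drop) simp
  also have "drop (Suc a) ws ! (b - Suc a) = (fst (ws ! a), snd (ws ! b))"
    using assms by (simp add: prod_eq_iff)
  finally have "ws = take a ws @ (fst (ws ! a), snd (ws ! a)) # ?us @
      (fst (ws ! a), snd (ws ! b)) # drop (Suc (b - Suc a)) (drop (Suc a) ws)"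
    by (simp only: prod.collapse)
  then obtain w where "w \<in> fst ` set ?us" "w \<noteq> fst (ws ! a)" "{fst (ws ! a), w} \<notin> E"
    using assms(1) unfolding reduced_word_def by blast
  then obtain m where "m < b - Suc a" "fst (ws ! (Suc a + m)) \<noteq> fst (ws ! a)"
      "{fst (ws ! a), fst (ws ! (Suc a + m))} \<notin> E"
    using assms(2,3) by (auto simp: in_set_conv_nth)
  then show ?thesis by (intro exI[of _ "Suc a + m"]) auto
qed

lemma word_eval_simps [simp]:
  "word_eval H h [] = \<one>\<^bsub>H\<^esub>"
  "word_eval H h ((v, a) # xs) = h v a \<otimes>\<^bsub>H\<^esub> word_eval H h xs"
  by (simp_all add: word_eval_def)

context graph_wreath
begin

abbreviation "GP \<equiv> graph_product V E \<Delta>"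
abbreviation "cls \<equiv> word_class V E \<Delta>"

sublocale GP: group GP
  by (rule graph_product_group) (rule \<Delta>.is_group)

lemma no_loop: "{v, v} \<notin> E"
  using edges[of "{v, v}"] by (auto simp: doubleton_eq_iff)

lemma cls_carrier: "xs \<in> W \<Longrightarrow> cls xs \<in> carrier GP"
  by (auto simp: word_class_def graph_product_def FactGroup_def intro!: P.rcosetsI N.subset class_in_carrier)

lemma cls_append: "xs \<in> W \<Longrightarrow> ys \<in> W \<Longrightarrow> cls (xs @ ys) = cls xs \<otimes>\<^bsub>GP\<^esub> cls ys"
  by (simp add: word_class_def graph_product_def FactGroup_def N.rcos_sum class_in_carrier mult_class)

lemma cls_Nil: "cls [] = \<one>\<^bsub>GP\<^esub>"
  using N.subset by (simp add: word_class_def graph_product_def FactGroup_def one_class[symmetric])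

lemma cls_cases:
  assumes "X \<in> carrier GP" obtains xs where "xs \<in> W" "X = cls xs"
  using assms by (elim graph_product_cases carrier_cases) (auto simp: word_class_def)

lemma cls_rel: "(xs, ys) \<in> R \<Longrightarrow> cls xs = cls ys"
  by (simp add: word_class_def equiv_class_eq[OF equiv_rel])

lemma cls_context:
  assumes "cls xs = cls ys" "xs \<in> W" "ys \<in> W" "as \<in> W" "bs \<in> W"
  shows "cls (as @ xs @ bs) = cls (as @ ys @ bs)"
  using assms by (simp add: cls_append)

lemma cls_singleton: "v \<in> V \<Longrightarrow> (\<lambda>a. cls [(v, a)]) \<in> hom \<Delta> GP"
  using cls_rel[OF free_product_rel.merge[of "[]" V "\<lambda>_. \<Delta>" "[]" v]]
  by (intro homI) (auto simp: cls_carrier simp flip: cls_append)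

lemma cls_commute:
  assumes "v \<in> V" "w \<in> V" "{v, w} \<in> E" "a \<in> carrier \<Delta>" "b \<in> carrier \<Delta>"
  shows "cls [(v, a), (w, b)] = cls [(w, b), (v, a)]"
proof -
  let ?A = "free_product_inj V (\<lambda>_. \<Delta>) v a" and ?B = "free_product_inj V (\<lambda>_. \<Delta>) w b"
  let ?c = "?A \<otimes>\<^bsub>P\<^esub> ?B \<otimes>\<^bsub>P\<^esub> inv\<^bsub>P\<^esub> ?A \<otimes>\<^bsub>P\<^esub> inv\<^bsub>P\<^esub> ?B"
  have AB: "?A \<in> carrier P" "?B \<in> carrier P" using assms by (auto simp: inj_carrier)
  have "?c \<in> graph_product_commutators V E \<Delta>"
    using assms unfolding graph_product_commutators_def Let_def by blast
  then have c: "?c \<in> N" by (rule subsetD[OF normal_closure_superset])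
  have "inv\<^bsub>P\<^esub> ?B \<otimes>\<^bsub>P\<^esub> (?B \<otimes>\<^bsub>P\<^esub> ?A) = ?A"
    using AB by (metis P.m_assoc P.l_inv P.l_one P.inv_closed)
  then have "?A \<otimes>\<^bsub>P\<^esub> ?B = ?c \<otimes>\<^bsub>P\<^esub> (?B \<otimes>\<^bsub>P\<^esub> ?A)"
    using AB by (simp add: P.m_assoc)
  then have "N #>\<^bsub>P\<^esub> (?A \<otimes>\<^bsub>P\<^esub> ?B) = (N #>\<^bsub>P\<^esub> ?c) #>\<^bsub>P\<^esub> (?B \<otimes>\<^bsub>P\<^esub> ?A)"
    using AB by (simp add: P.coset_mult_assoc N.subset)
  also have "N #>\<^bsub>P\<^esub> ?c = N" using c by (simp add: N.rcos_const P.is_group)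
  finally show ?thesis
    using assms by (simp add: word_class_def free_product_inj_def mult_class)
qed

lemma relabel_cls: "\<gamma> \<in> carrier \<Gamma> \<Longrightarrow> xs \<in> W \<Longrightarrow> relabel (\<phi> \<gamma>) (cls xs) = cls (ren \<gamma> xs)"
  by (simp add: word_class_def relabel_coset class_in_carrier ren_class)

lemma cls_commute_past:
  assumes "v \<in> V" "a \<in> carrier \<Delta>" "ys \<in> W" "\<forall>w\<in>fst ` set ys. {v, w} \<in> E"
  shows "cls ((v, a) # ys) = cls (ys @ [(v, a)])"
  using assms(3,4)
proof (induction ys)
  case (Cons y ys)
  obtain w b where y: "y = (w, b)" by force
  have "cls ((v, a) # y # ys) = cls (y # (v, a) # ys)"
    using cls_context[OF cls_commute, of v w a b "[]" ys] assms(1,2) Cons.prems y by simp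
  also have "\<dots> = cls (y # ys @ [(v, a)])"
    using cls_context[of "(v, a) # ys" "ys @ [(v, a)]" "[y]" "[]"] Cons assms(1,2) by simp
  finally show ?case by simp
qed simp

text \<open>A trivial letter can be deleted; otherwise a letter at \<open>v\<close> can be swapped
  to the right until it meets another letter at \<open>v\<close>, and the two merge.\<close>

lemma not_reduced_shorten:
  assumes xs: "xs \<in> W" and "\<not> reduced_word E \<Delta> xs"
  obtains ys where "ys \<in> W" "cls ys = cls xs" "length ys < length xs"
proof -
  consider x where "x \<in> set xs" "snd x = \<one>\<^bsub>\<Delta>\<^esub>"
    | as v a bs b cs where "xs = as @ (v, a) # bs @ (v, b) # cs" "\<forall>w\<in>fst ` set bs. w = v \<or> {v, w} \<in> E"
    using assms(2) unfolding reduced_word_def by blast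
  then show thesis
  proof cases
    case 1
    then obtain v as bs where eq: "xs = as @ (v, \<one>\<^bsub>\<Delta>\<^esub>) # bs"
      by (metis prod.collapse split_list)
    then have "cls xs = cls (as @ bs)"
      using xs cls_rel[OF free_product_rel.unit[of as V "\<lambda>_. \<Delta>" bs v]] by simp
    then show thesis using eq xs by (intro that[of "as @ bs"]) auto
  next
    case 2
    \<comment> \<open>\<open>bs\<close> may itself contain letters at \<open>v\<close>. The partner
      is therefore the first letter at \<open>v\<close> after \<open>a\<close>, so that all of
      \<open>bs'\<close> is adjacent to \<open>v\<close>.\<close>
    have "v \<in> fst ` set (bs @ [(v, b)])" by simp
    then obtain bs' b' cs' where split: "bs @ [(v, b)] = bs' @ (v, b') # cs'" "v \<notin> fst ` set bs'"
      using split_list_first_prop[of "bs @ [(v, b)]" "\<lambda>x. fst x = v"] by fastforce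
    have "set bs' \<subseteq> set bs"
      using split(1) by (cases cs' rule: rev_cases) auto
    then have adj: "\<forall>w\<in>fst ` set bs'. {v, w} \<in> E"
      using 2(2) split(2) by (metis image_mono subsetD)
    have eq: "xs = as @ (v, a) # bs' @ (v, b') # cs' @ cs"
      using 2(1) arg_cong[OF split(1), of "\<lambda>t. as @ (v, a) # t @ cs"] by simp
    have "cls xs = cls (as @ ((v, a) # bs') @ (v, b') # cs' @ cs)" using eq by simp
    also have "\<dots> = cls (as @ (bs' @ [(v, a)]) @ (v, b') # cs' @ cs)"
      using xs eq adj by (intro cls_context cls_commute_past) auto
    also have "\<dots> = cls ((as @ bs') @ (v, a \<otimes>\<^bsub>\<Delta>\<^esub> b') # cs' @ cs)"
      using xs eq cls_rel[OF free_product_rel.merge[of "as @ bs'" V "\<lambda>_. \<Delta>" "cs' @ cs" v a b']] by simp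
    finally show thesis
      using xs eq by (intro that[of "(as @ bs') @ (v, a \<otimes>\<^bsub>\<Delta>\<^esub> b') # cs' @ cs"]) auto
  qed
qed

text \<open>A shortest word representing \<open>X\<close> is reduced, as it cannot be
  shortened.\<close>

lemma reduced_word_exists:
  assumes "X \<in> carrier GP"
  obtains xs where "xs \<in> W" "X = cls xs" "reduced_word E \<Delta> xs"
proof -
  let ?Q = "\<lambda>xs. xs \<in> W \<and> X = cls xs"
  obtain xs0 where "?Q xs0" using cls_cases[OF assms] by blast
  then obtain xs where xs: "?Q xs" "\<And>ys. ?Q ys \<Longrightarrow> length xs \<le> length ys"
    using exists_least_iff[of "\<lambda>n. \<exists>xs. ?Q xs \<and> length xs = n"] by (metis linorder_not_less)
  have "reduced_word E \<Delta> xs"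
    using not_reduced_shorten[of xs] xs by (metis linorder_not_less)
  then show thesis using that xs(1) by blast
qed

subsection \<open>Universal properties\<close>

lemma word_eval_closed:
  assumes "group H" "\<And>v. v \<in> V \<Longrightarrow> h v \<in> hom \<Delta> H" "xs \<in> W"
  shows "word_eval H h xs \<in> carrier H"
proof -
  interpret H: group H by fact
  show ?thesis using assms(3)
  proof (induction xs)
    case (Cons x xs)
    then show ?case using assms(2)[of "fst x"] by (cases x) (auto simp: hom_def)
  qed simp
qed

lemma word_eval_append:
  assumes "group H" "\<And>v. v \<in> V \<Longrightarrow> h v \<in> hom \<Delta> H" "xs \<in> W" "ys \<in> W"
  shows "word_eval H h (xs @ ys) = word_eval H h xs \<otimes>\<^bsub>H\<^esub> word_eval H h ys"
proof -
  interpret H: group H by fact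
  note cl = word_eval_closed[OF assms(1,2)]
  show ?thesis using assms(3,4)
  proof (induction xs)
    case (Cons x xs)
    obtain v a where x: "x = (v, a)" by force
    then have "h v a \<in> carrier H" using assms(2)[of v] Cons.prems by (auto simp: hom_def)
    then show ?case using Cons x by (simp add: H.m_assoc cl)
  qed (simp add: cl)
qed

lemma word_eval_rel:
  assumes "group H" "\<And>v. v \<in> V \<Longrightarrow> h v \<in> hom \<Delta> H" "(xs, ys) \<in> R"
  shows "word_eval H h xs = word_eval H h ys"
proof -
  interpret H: group H by fact
  note cl = word_eval_closed[OF assms(1,2)] and app = word_eval_append[OF assms(1,2)]
  have hc: "h v a \<in> carrier H" if "v \<in> V" "a \<in> carrier \<Delta>" for v a
    using assms(2)[OF that(1)] that(2) by (auto simp: hom_def)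
  from assms(3) show ?thesis
  proof (induction rule: free_product_rel.induct)
    case (unit xs ys i)
    then show ?case
      using hom_one[OF assms(2) \<Delta>.is_group \<open>group H\<close>] by (simp add: app cl)
  next
    case (merge xs ys i a b)
    then show ?case
      using assms(2)[of i] by (simp add: app cl hc hom_def H.m_assoc)
  qed auto
qed

text \<open>Evaluating words gives a homomorphism on the free product. Its kernel is normal and
  contains the defining commutators, hence their normal closure, so the map factors through the
  quotient.\<close>

lemma graph_product_universal:
  assumes H: "group H" and h: "\<And>v. v \<in> V \<Longrightarrow> h v \<in> hom \<Delta> H"
    and comm: "\<And>v w a b. v \<in> V \<Longrightarrow> w \<in> V \<Longrightarrow> {v, w} \<in> E \<Longrightarrow> a \<in> carrier \<Delta> \<Longrightarrow> b \<in> carrier \<Delta> \<Longrightarrow>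
      h v a \<otimes>\<^bsub>H\<^esub> h w b = h w b \<otimes>\<^bsub>H\<^esub> h v a"
  obtains f where "f \<in> hom GP H" "\<And>xs. xs \<in> W \<Longrightarrow> f (cls xs) = word_eval H h xs"
proof -
  interpret H: group H by fact
  note cl = word_eval_closed[OF H h] and app = word_eval_append[OF H h]
  have hc: "h v a \<in> carrier H" if "v \<in> V" "a \<in> carrier \<Delta>" for v a
    using h[OF that(1)] that(2) by (auto simp: hom_def)
  \<comment> \<open>The representative is arbitrary; \<open>word_eval_rel\<close> makes the value
    independent of it.\<close>
  define p where "p A = word_eval H h (SOME xs. xs \<in> W \<and> A = R `` {xs})" for A
  have p: "p (R `` {xs}) = word_eval H h xs" if "xs \<in> W" for xs
  proof -
    define ys where "ys = (SOME ys. ys \<in> W \<and> R `` {xs} = R `` {ys})"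
    have ys: "ys \<in> W \<and> R `` {xs} = R `` {ys}"
      unfolding ys_def by (rule someI[of _ xs]) (use that in simp)
    then have "(xs, ys) \<in> R" using eq_equiv_class[OF _ equiv_rel] by blast
    then show ?thesis using word_eval_rel[OF H h] by (simp add: p_def flip: ys_def)
  qed
  interpret p: group_hom P H p
    by (unfold_locales, rule homI; elim carrier_cases) (auto simp: p cl app mult_class)
  have "graph_product_commutators V E \<Delta> \<subseteq> kernel P H p"
  proof
    fix c assume "c \<in> graph_product_commutators V E \<Delta>"
    then obtain v w a b where vw: "v \<in> V" "w \<in> V" "{v, w} \<in> E" "a \<in> carrier \<Delta>" "b \<in> carrier \<Delta>"
      and c: "c = free_product_inj V (\<lambda>_. \<Delta>) v a \<otimes>\<^bsub>P\<^esub> free_product_inj V (\<lambda>_. \<Delta>) w b \<otimes>\<^bsub>P\<^esub>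
        inv\<^bsub>P\<^esub> (free_product_inj V (\<lambda>_. \<Delta>) v a) \<otimes>\<^bsub>P\<^esub> inv\<^bsub>P\<^esub> (free_product_inj V (\<lambda>_. \<Delta>) w b)"
      by (auto simp: graph_product_commutators_def Let_def)
    have pi: "p (free_product_inj V (\<lambda>_. \<Delta>) u d) = h u d" if "u \<in> V" "d \<in> carrier \<Delta>" for u d
      using that by (simp add: free_product_inj_def p hc)
    have "p c = h v a \<otimes>\<^bsub>H\<^esub> h w b \<otimes>\<^bsub>H\<^esub> inv\<^bsub>H\<^esub> (h v a) \<otimes>\<^bsub>H\<^esub> inv\<^bsub>H\<^esub> (h w b)"
      using vw by (simp add: c inj_carrier pi)
    also have "\<dots> = h w b \<otimes>\<^bsub>H\<^esub> h v a \<otimes>\<^bsub>H\<^esub> inv\<^bsub>H\<^esub> (h v a) \<otimes>\<^bsub>H\<^esub> inv\<^bsub>H\<^esub> (h w b)"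
      using comm[OF vw] by simp
    also have "\<dots> = \<one>\<^bsub>H\<^esub>"
      using vw hc by (metis H.inv_solve_right' H.m_closed H.r_inv)
    finally show "c \<in> kernel P H p"
      using vw by (auto simp: kernel_def c inj_carrier)
  qed
  then have Nk: "N \<subseteq> kernel P H p" by (intro normal_closure_least p.normal_kernel)
  \<comment> \<open>\<open>p\<close> is constant on each coset of \<open>N\<close>, so its image
    there is a singleton.\<close>
  define f where "f X = the_elem (p ` X)" for X
  have f: "f (cls xs) = word_eval H h xs" if "xs \<in> W" for xs
  proof -
    have A: "R `` {xs} \<in> carrier P" using that by (rule class_in_carrier)
    have "p (B \<otimes>\<^bsub>P\<^esub> R `` {xs}) = p (R `` {xs})" if "B \<in> N" for B
    proof -
      have "B \<in> carrier P" "p B = \<one>\<^bsub>H\<^esub>" using that Nk by (auto simp: kernel_def)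
      then show ?thesis using A p.hom_closed[OF A] by simp
    qed
    then have "p ` (N #>\<^bsub>P\<^esub> (R `` {xs})) = {p (R `` {xs})}"
      by (auto simp: r_coset_def image_UN intro: N.one_closed)
    then show ?thesis using that by (simp add: f_def word_class_def p)
  qed
  have "f \<in> hom GP H"
  proof (rule homI)
    fix X assume "X \<in> carrier GP"
    then show "f X \<in> carrier H" by (elim cls_cases) (simp add: f cl)
  next
    fix X Y assume "X \<in> carrier GP" "Y \<in> carrier GP"
    then obtain xs ys where "xs \<in> W" "X = cls xs" "ys \<in> W" "Y = cls ys"
      using cls_cases by metis
    then show "f (X \<otimes>\<^bsub>GP\<^esub> Y) = f X \<otimes>\<^bsub>H\<^esub> f Y"
      by (simp add: f app flip: cls_append)
  qed
  then show thesis using f that by blast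
qed

abbreviation "GWP \<equiv> graph_wreath_product V E \<Delta> \<Gamma> \<phi>"

lemma GWP_simps [simp]:
  "carrier GWP = carrier GP \<times> carrier \<Gamma>"
  "\<one>\<^bsub>GWP\<^esub> = (\<one>\<^bsub>GP\<^esub>, \<one>\<^bsub>\<Gamma>\<^esub>)"
  "(X, \<gamma>) \<otimes>\<^bsub>GWP\<^esub> (X', \<gamma>') = (X \<otimes>\<^bsub>GP\<^esub> relabel (\<phi> \<gamma>) X', \<gamma> \<otimes>\<^bsub>\<Gamma>\<^esub> \<gamma>')"
  by (simp_all add: graph_wreath_product_def semidirect_product_def)

text \<open>A homomorphism from a semidirect product is a pair of homomorphisms on the factors that
  respects the action; by \<open>compat\<close> it suffices to check this on single letters.\<close>

lemma graph_wreath_product_universal: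
  assumes H: "group H" and h: "\<And>v. v \<in> V \<Longrightarrow> h v \<in> hom \<Delta> H"
    and comm: "\<And>v w a b. v \<in> V \<Longrightarrow> w \<in> V \<Longrightarrow> {v, w} \<in> E \<Longrightarrow> a \<in> carrier \<Delta> \<Longrightarrow> b \<in> carrier \<Delta> \<Longrightarrow>
      h v a \<otimes>\<^bsub>H\<^esub> h w b = h w b \<otimes>\<^bsub>H\<^esub> h v a"
    and t: "t \<in> hom \<Gamma> H"
    and compat: "\<And>\<gamma> v a. \<gamma> \<in> carrier \<Gamma> \<Longrightarrow> v \<in> V \<Longrightarrow> a \<in> carrier \<Delta> \<Longrightarrow>
      t \<gamma> \<otimes>\<^bsub>H\<^esub> h v a = h (\<phi> \<gamma> v) a \<otimes>\<^bsub>H\<^esub> t \<gamma>"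
  obtains f where "f \<in> hom GWP H"
    "\<And>xs \<gamma>. xs \<in> W \<Longrightarrow> \<gamma> \<in> carrier \<Gamma> \<Longrightarrow> f (cls xs, \<gamma>) = word_eval H h xs \<otimes>\<^bsub>H\<^esub> t \<gamma>"
proof -
  interpret H: group H by fact
  note cl = word_eval_closed[OF H h] and app = word_eval_append[OF H h]
  have hc: "h v a \<in> carrier H" if "v \<in> V" "a \<in> carrier \<Delta>" for v a
    using h[OF that(1)] that(2) by (auto simp: hom_def)
  have tc: "t \<gamma> \<in> carrier H" if "\<gamma> \<in> carrier \<Gamma>" for \<gamma> using t that by (auto simp: hom_def)
  \<comment> \<open>Letter by letter, \<open>t \<gamma>\<close> moves past a word and relabels
    it.\<close>
  have ev: "t \<gamma> \<otimes>\<^bsub>H\<^esub> word_eval H h xs = word_eval H h (ren \<gamma> xs) \<otimes>\<^bsub>H\<^esub> t \<gamma>"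
    if "\<gamma> \<in> carrier \<Gamma>" "xs \<in> W" for \<gamma> xs
    using that(2)
  proof (induction xs)
    case (Cons x xs)
    obtain v a where x: "x = (v, a)" by force
    have va: "v \<in> V" "a \<in> carrier \<Delta>" "xs \<in> W" "\<phi> \<gamma> v \<in> V" "ren \<gamma> xs \<in> W"
      using Cons.prems x that by (auto simp: \<phi>_closed ren_words)
    have "t \<gamma> \<otimes>\<^bsub>H\<^esub> word_eval H h (x # xs) = (t \<gamma> \<otimes>\<^bsub>H\<^esub> h v a) \<otimes>\<^bsub>H\<^esub> word_eval H h xs"
      using va that by (simp add: x H.m_assoc tc hc cl)
    also have "\<dots> = h (\<phi> \<gamma> v) a \<otimes>\<^bsub>H\<^esub> (t \<gamma> \<otimes>\<^bsub>H\<^esub> word_eval H h xs)"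
      using va that by (simp add: compat H.m_assoc tc hc cl)
    also have "\<dots> = word_eval H h (ren \<gamma> (x # xs)) \<otimes>\<^bsub>H\<^esub> t \<gamma>"
      using Cons.IH va that by (simp add: x H.m_assoc tc hc cl)
    finally show ?case .
  qed (use tc that in simp)
  obtain g where g: "g \<in> hom GP H" "\<And>xs. xs \<in> W \<Longrightarrow> g (cls xs) = word_eval H h xs"
    using graph_product_universal[of H h, OF H h comm] by blast
  define f where "f = (\<lambda>(X, \<gamma>). g X \<otimes>\<^bsub>H\<^esub> t \<gamma>)"
  have f: "f (cls xs, \<gamma>) = word_eval H h xs \<otimes>\<^bsub>H\<^esub> t \<gamma>" if "xs \<in> W" for xs \<gamma>
    using that by (simp add: f_def g(2))
  have "f \<in> hom GWP H"
  proof (rule homI)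
    fix x assume "x \<in> carrier GWP"
    then show "f x \<in> carrier H" using g(1) tc by (auto simp: f_def hom_def)
  next
    fix x y assume "x \<in> carrier GWP" "y \<in> carrier GWP"
    then obtain xs \<gamma> ys \<gamma>' where x: "x = (cls xs, \<gamma>)" "xs \<in> W" "\<gamma> \<in> carrier \<Gamma>"
      and y: "y = (cls ys, \<gamma>')" "ys \<in> W" "\<gamma>' \<in> carrier \<Gamma>"
      using cls_cases by (metis GWP_simps(1) mem_Times_iff prod.collapse)
    have r: "ren \<gamma> ys \<in> W" using x y ren_words by blast
    have "f (x \<otimes>\<^bsub>GWP\<^esub> y) = word_eval H h (xs @ ren \<gamma> ys) \<otimes>\<^bsub>H\<^esub> t (\<gamma> \<otimes>\<^bsub>\<Gamma>\<^esub> \<gamma>')"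
      using x y r by (simp add: relabel_cls f flip: cls_append)
    also have "\<dots> = word_eval H h xs \<otimes>\<^bsub>H\<^esub> (word_eval H h (ren \<gamma> ys) \<otimes>\<^bsub>H\<^esub> t \<gamma>) \<otimes>\<^bsub>H\<^esub> t \<gamma>'"
      using x y r t by (simp add: app cl hom_def H.m_assoc tc)
    also have "\<dots> = f x \<otimes>\<^bsub>H\<^esub> f y"
      using x y r by (simp add: f cl tc H.m_assoc flip: ev)
    finally show "f (x \<otimes>\<^bsub>GWP\<^esub> y) = f x \<otimes>\<^bsub>H\<^esub> f y" .
  qed
  then show thesis using f that by blast
qed

subsection \<open>Separating reduced words\<close>

text \<open>By \<open>sep\<close>, translating by the kernel of \<open>\<kappa>\<close> neither
  identifies distinct vertices of \<open>ws\<close> nor creates adjacencies between them. A vertex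
  may become adjacent to its own translate if \<Delta> is abelian, because two actions on the same
  coordinate then commute.\<close>

lemma separating_representation:
  fixes F :: "('f, 'k) monoid_scheme" and Q :: "('q, 'l) monoid_scheme"
  assumes F: "group F" and f: "f \<in> hom \<Delta> F" and Q: "group Q" and \<kappa>: "\<kappa> \<in> hom \<Gamma> Q"
    and ws: "ws \<in> W" "reduced_word E \<Delta> ws" "ws \<noteq> []"
    and f_ws: "\<And>x. x \<in> set ws \<Longrightarrow> f (snd x) \<noteq> \<one>\<^bsub>F\<^esub>"
    and sep: "\<And>k v w. k \<in> carrier \<Gamma> \<Longrightarrow> \<kappa> k = \<one>\<^bsub>Q\<^esub> \<Longrightarrow> v \<in> fst ` set ws \<Longrightarrow> w \<in> fst ` set ws \<Longrightarrow>
      (\<phi> k v = w \<longrightarrow> v = w) \<and> ({v, \<phi> k w} \<in> E \<longrightarrow> {v, w} \<in> E \<or> v = w \<and> comm_group \<Delta>)"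
  obtains \<Psi> where
    "\<Psi> \<in> hom GWP (BijGroup (({..<length ws} \<rightarrow>\<^sub>E carrier F) \<times> carrier Q))"
    "\<Psi> (cls ws, \<one>\<^bsub>\<Gamma>\<^esub>) \<noteq> \<one>\<^bsub>BijGroup (({..<length ws} \<rightarrow>\<^sub>E carrier F) \<times> carrier Q)\<^esub>"
proof -
  interpret F: group F by fact
  interpret Q: group Q by fact
  interpret \<kappa>: group_hom \<Gamma> Q \<kappa> using \<kappa> by unfold_locales
  interpret f: group_hom \<Delta> F f using f by unfold_locales
  define n where "n = length ws"
  define v where "v i = fst (ws ! i)" for i
  define g where "g i = f (snd (ws ! i))" for i
  define X where "X = {..<n} \<rightarrow>\<^sub>E carrier F"
  define Y where "Y = X \<times> carrier Q"
  define B where "B = BijGroup Y"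
  define act where "act i u q \<longleftrightarrow> (\<exists>\<gamma>\<in>carrier \<Gamma>. \<kappa> \<gamma> = q \<and> u = \<phi> \<gamma> (v i))" for i u q
  \<comment> \<open>Letters act from right to left: at the turn of letter \<open>i\<close>,
    positions beyond \<open>i\<close> already hold their \<open>g j\<close> and earlier ones still
    hold the identity. Only positions that block \<open>v i\<close> are consulted.\<close>
  define cond where "cond i x \<longleftrightarrow>
    (\<forall>j<n. v j \<noteq> v i \<and> {v i, v j} \<notin> E \<longrightarrow> x j = (if i < j then g j else \<one>\<^bsub>F\<^esub>))" for i x
  define A where "A u b = (\<lambda>(x, q). (\<lambda>i\<in>{..<n}. if act i u q \<and> cond i x then b \<otimes>\<^bsub>F\<^esub> x i else x i, q))"
    for u b

  have ws_nth: "v i \<in> V" "v i \<in> fst ` set ws" "snd (ws ! i) \<in> carrier \<Delta>"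
    "g i \<in> carrier F" "g i \<noteq> \<one>\<^bsub>F\<^esub>" if "i < n" for i
  proof -
    have m: "ws ! i \<in> set ws" using that by (simp add: n_def)
    then have "fst (ws ! i) \<in> V" "snd (ws ! i) \<in> carrier \<Delta>"
      using ws(1) unfolding free_product_words_def by (auto simp: in_lists_conv_set)
    then show "v i \<in> V" "v i \<in> fst ` set ws" "snd (ws ! i) \<in> carrier \<Delta>"
        "g i \<in> carrier F" "g i \<noteq> \<one>\<^bsub>F\<^esub>"
      using m f_ws by (auto simp: v_def g_def)
  qed
  \<comment> \<open>Two elements of \<Gamma> with image \<open>q\<close> differ by an element of the
    kernel of \<open>\<kappa>\<close>, to which \<open>sep\<close> applies.\<close>
  have act_eq: "v i = v j" if ac: "act i u q" "act j u q" and "i < n" "j < n" for i j u q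
  proof -
    obtain \<gamma> where \<gamma>: "\<gamma> \<in> carrier \<Gamma>" "\<kappa> \<gamma> = q" "u = \<phi> \<gamma> (v i)"
      using ac(1) unfolding act_def by blast
    obtain \<delta> where \<delta>: "\<delta> \<in> carrier \<Gamma>" "\<kappa> \<delta> = q" "u = \<phi> \<delta> (v j)"
      using ac(2) unfolding act_def by blast
    have "\<phi> (inv\<^bsub>\<Gamma>\<^esub> \<delta> \<otimes>\<^bsub>\<Gamma>\<^esub> \<gamma>) (v i) = v j"
    proof -
      have "\<phi> (inv\<^bsub>\<Gamma>\<^esub> \<delta>) u = v j"
        using orbit_sym_aux[OF \<delta>(1) ws_nth(1)] that(4) \<delta>(3) by blast
      then show ?thesis
        using \<gamma>(3) composition_rule[OF ws_nth(1)[OF that(3)] \<Gamma>.inv_closed[OF \<delta>(1)] \<gamma>(1)] by simp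
    qed
    moreover have "\<kappa> (inv\<^bsub>\<Gamma>\<^esub> \<delta> \<otimes>\<^bsub>\<Gamma>\<^esub> \<gamma>) = \<one>\<^bsub>Q\<^esub>"
      using \<kappa>.hom_closed[OF \<gamma>(1)] \<gamma>(1,2) \<delta>(1,2) by simp
    ultimately show ?thesis
      using sep[of "inv\<^bsub>\<Gamma>\<^esub> \<delta> \<otimes>\<^bsub>\<Gamma>\<^esub> \<gamma>" "v i" "v j"] \<gamma>(1) \<delta>(1) ws_nth(2) that(3,4) by simp
  qed
  \<comment> \<open>Pulled back by the inverse of \<open>\<gamma>\<close>, the edge joins
    \<open>v i\<close> to a kernel translate of \<open>v j\<close>.\<close>
  have act_adj: "{v i, v j} \<in> E \<or> v i = v j \<and> comm_group \<Delta>"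
    if ac: "act i u q" "act j w q" and "i < n" "j < n" "{u, w} \<in> E" for i j u w q
  proof -
    obtain \<gamma> where \<gamma>: "\<gamma> \<in> carrier \<Gamma>" "\<kappa> \<gamma> = q" "u = \<phi> \<gamma> (v i)"
      using ac(1) unfolding act_def by blast
    obtain \<delta> where \<delta>: "\<delta> \<in> carrier \<Gamma>" "\<kappa> \<delta> = q" "w = \<phi> \<delta> (v j)"
      using ac(2) unfolding act_def by blast
    have uw: "u \<in> V" "w \<in> V" using \<gamma> \<delta> ws_nth(1) that by (simp_all add: \<phi>_closed)
    have "{\<phi> (inv\<^bsub>\<Gamma>\<^esub> \<gamma>) u, \<phi> (inv\<^bsub>\<Gamma>\<^esub> \<gamma>) w} \<in> E"
      using automorphism[of "inv\<^bsub>\<Gamma>\<^esub> \<gamma>"] \<gamma>(1) uw that(5) by (auto simp: graph_automorphism_def)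
    moreover have "\<phi> (inv\<^bsub>\<Gamma>\<^esub> \<gamma>) u = v i"
      using orbit_sym_aux[OF \<gamma>(1) ws_nth(1)] that(3) \<gamma>(3) by blast
    moreover have "\<phi> (inv\<^bsub>\<Gamma>\<^esub> \<gamma>) w = \<phi> (inv\<^bsub>\<Gamma>\<^esub> \<gamma> \<otimes>\<^bsub>\<Gamma>\<^esub> \<delta>) (v j)"
      using composition_rule[OF ws_nth(1)[OF that(4)] \<Gamma>.inv_closed[OF \<gamma>(1)] \<delta>(1)] \<delta>(3) by simp
    moreover have "\<kappa> (inv\<^bsub>\<Gamma>\<^esub> \<gamma> \<otimes>\<^bsub>\<Gamma>\<^esub> \<delta>) = \<one>\<^bsub>Q\<^esub>"
      using \<kappa>.hom_closed[OF \<gamma>(1)] \<gamma>(1,2) \<delta>(1,2) by simp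
    ultimately show ?thesis
      using sep[of "inv\<^bsub>\<Gamma>\<^esub> \<gamma> \<otimes>\<^bsub>\<Gamma>\<^esub> \<delta>" "v i" "v j"] \<gamma>(1) \<delta>(1) ws_nth(2) that(3,4) by simp
  qed

  have A_closed: "A u b y \<in> Y" if "b \<in> carrier F" "y \<in> Y" for u b y
  proof -
    obtain x q where "y = (x, q)" by force
    moreover from this have "x \<in> X" "q \<in> carrier Q" using that(2) by (simp_all add: Y_def)
    moreover from this have "x i \<in> carrier F" if "i < n" for i
      using that unfolding X_def by (intro PiE_mem[of x]) auto
    ultimately show ?thesis using that(1) by (simp add: A_def Y_def X_def)
  qed
  have A_nth: "fst (A u b (x, q)) i = (if act i u q \<and> cond i x then b \<otimes>\<^bsub>F\<^esub> x i else x i)"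
    if "i < n" for u b x q i
    using that by (simp add: A_def)
  have A_snd: "snd (A u b (x, q)) = q" for u b x q by (simp add: A_def)
  have Y_eqI: "y = z" if "y \<in> Y" "z \<in> Y" "snd y = snd z" "\<And>i. i < n \<Longrightarrow> fst y i = fst z i" for y z
  proof -
    have "fst y \<in> X" "fst z \<in> X" using that(1,2) by (auto simp: Y_def)
    then have "fst y = fst z" unfolding X_def by (rule PiE_ext) (use that(4) in simp)
    then show ?thesis using that(3) by (simp add: prod_eq_iff)
  qed
  \<comment> \<open>The condition at position \<open>i\<close> only reads positions with vertex neither equal nor adjacent to
    \<open>v i\<close>, and these are not moved by letters at \<open>u\<close> or at neighbours of \<open>u\<close>.\<close>
  have cond_A: "cond i (fst (A w b (x, q))) = cond i x"
    if "act i u q" "i < n" "w = u \<or> {u, w} \<in> E" for i u w b x q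
  proof -
    have "fst (A w b (x, q)) j = x j" if j: "j < n" "v j \<noteq> v i" "{v i, v j} \<notin> E" for j
    proof -
      have "\<not> act j w q"
        using act_eq[of i u q j] act_adj[of i u q j w] \<open>act i u q\<close> \<open>i < n\<close> \<open>w = u \<or> {u, w} \<in> E\<close> j by auto
      then show ?thesis using j by (simp add: A_nth)
    qed
    then show ?thesis unfolding cond_def by (metis (no_types, lifting))
  qed
  \<comment> \<open>By \<open>cond_A\<close> the second operator can test its condition on the
    original \<open>x\<close>. Multiplicativity at one vertex and commutation at adjacent vertices
    become coordinatewise computations.\<close>
  have A_A_nth: "fst (A u b (A w c (x, q))) i =
      (if act i u q \<and> cond i x then b \<otimes>\<^bsub>F\<^esub> fst (A w c (x, q)) i else fst (A w c (x, q)) i)"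
    if "w = u \<or> {u, w} \<in> E" "i < n" for u b w c x q i
  proof -
    have "A w c (x, q) = (fst (A w c (x, q)), q)" by (simp add: prod_eq_iff A_snd)
    then have "fst (A u b (A w c (x, q))) i = (if act i u q \<and> cond i (fst (A w c (x, q)))
        then b \<otimes>\<^bsub>F\<^esub> fst (A w c (x, q)) i else fst (A w c (x, q)) i)"
      using A_nth[OF that(2)] by metis
    then show ?thesis using cond_A[OF _ that(2,1)] by auto
  qed
  have A_A_snd: "snd (A u b (A w c y)) = snd y" for u b w c y by (auto simp: A_def split: prod.split)
  have x_closed: "x i \<in> carrier F" if "(x, q) \<in> Y" "i < n" for x q i
    using that by (auto simp: Y_def X_def)

  define h where "h u b = restrict (A u (f b)) Y" for u b
  define t where "t \<gamma> = restrict (\<lambda>(x, q). (x, \<kappa> \<gamma> \<otimes>\<^bsub>Q\<^esub> q)) Y" for \<gamma>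
  have B: "group B" unfolding B_def by (rule group_BijGroup)
  interpret B: group B by fact
  have h: "h u \<in> hom \<Delta> B" if "u \<in> V" for u
    unfolding B_def h_def
  proof (rule hom_BijGroupI[OF \<Delta>.is_group])
    fix a b y assume ab: "a \<in> carrier \<Delta>" "b \<in> carrier \<Delta>" and y: "y \<in> Y"
    obtain x q where xq: "y = (x, q)" by force
    show "A u (f (a \<otimes>\<^bsub>\<Delta>\<^esub> b)) y = A u (f a) (A u (f b) y)"
      by (rule Y_eqI) (use ab y x_closed[of x q] in
        \<open>auto simp: xq A_closed A_snd A_A_snd A_A_nth A_nth F.m_assoc\<close>)
  next
    fix y assume y: "y \<in> Y"
    obtain x q where xq: "y = (x, q)" by force
    show "A u (f \<one>\<^bsub>\<Delta>\<^esub>) y = y"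
      by (rule Y_eqI) (use y x_closed[of x q] in \<open>auto simp: xq A_closed A_snd A_nth\<close>)
  qed (simp add: A_closed)
  have t: "t \<in> hom \<Gamma> B"
    unfolding B_def t_def by (rule hom_BijGroupI[OF \<Gamma>.is_group]) (auto simp: Y_def Q.m_assoc)
  have hc: "h u a \<in> carrier B" if "u \<in> V" "a \<in> carrier \<Delta>" for u a
    using h[OF that(1)] that(2) by (auto simp: hom_def)
  have tc: "t \<gamma> \<in> carrier B" if "\<gamma> \<in> carrier \<Gamma>" for \<gamma> using t that by (auto simp: hom_def)
  note B_apply = BijGroup_mult_apply[of _ Y, folded B_def]
  have comm: "h u a \<otimes>\<^bsub>B\<^esub> h w b = h w b \<otimes>\<^bsub>B\<^esub> h u a"
    if uw: "u \<in> V" "w \<in> V" "{u, w} \<in> E" and ab: "a \<in> carrier \<Delta>" "b \<in> carrier \<Delta>" for u w a b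
  proof (rule BijGroup_eqI[of _ Y, folded B_def])
    fix y assume y: "y \<in> Y"
    obtain x q where xq: "y = (x, q)" by force
    have wu: "{w, u} \<in> E" using uw(3) by (simp add: insert_commute)
    \<comment> \<open>Both operators move coordinate \<open>i\<close>, so \<open>act_adj\<close> is
      applied with both positions equal to \<open>i\<close>; as there are no loops, it yields that
      \<Delta> is abelian.\<close>
    have c: "f a \<otimes>\<^bsub>F\<^esub> (f b \<otimes>\<^bsub>F\<^esub> x i) = f b \<otimes>\<^bsub>F\<^esub> (f a \<otimes>\<^bsub>F\<^esub> x i)"
      if i: "i < n" "act i u q" "act i w q" for i
    proof -
      have "comm_group \<Delta>" using act_adj[OF i(2,3) i(1) i(1) uw(3)] no_loop by simp
      then have "a \<otimes>\<^bsub>\<Delta>\<^esub> b = b \<otimes>\<^bsub>\<Delta>\<^esub> a" using ab comm_groupE(4) by metis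
      then have "f a \<otimes>\<^bsub>F\<^esub> f b = f b \<otimes>\<^bsub>F\<^esub> f a" using ab by (metis f.hom_mult)
      then show ?thesis using ab x_closed[of x q i] y xq i by (simp flip: F.m_assoc)
    qed
    have "A u (f a) (A w (f b) y) = A w (f b) (A u (f a) y)"
      by (rule Y_eqI) (use uw wu ab y c in
        \<open>auto simp: xq A_closed A_snd A_A_snd A_A_nth A_nth\<close>)
    then show "(h u a \<otimes>\<^bsub>B\<^esub> h w b) y = (h w b \<otimes>\<^bsub>B\<^esub> h u a) y"
      using uw ab y A_closed by (simp add: B_apply hc) (simp add: h_def)
  qed (use that hc in auto)
  have compat: "t \<gamma> \<otimes>\<^bsub>B\<^esub> h u a = h (\<phi> \<gamma> u) a \<otimes>\<^bsub>B\<^esub> t \<gamma>"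
    if \<gamma>: "\<gamma> \<in> carrier \<Gamma>" and u: "u \<in> V" and a: "a \<in> carrier \<Delta>" for \<gamma> u a
  proof (rule BijGroup_eqI[of _ Y, folded B_def])
    fix y assume y: "y \<in> Y"
    obtain x q where xq: "y = (x, q)" by force
    have q: "q \<in> carrier Q" using y xq by (simp add: Y_def)
    have shift: "act i (\<phi> \<delta> w) (\<kappa> \<delta> \<otimes>\<^bsub>Q\<^esub> p)"
      if ac: "act i w p" and "i < n" "\<delta> \<in> carrier \<Gamma>" for i w p \<delta>
    proof -
      obtain \<epsilon> where "\<epsilon> \<in> carrier \<Gamma>" "\<kappa> \<epsilon> = p" "w = \<phi> \<epsilon> (v i)" using ac unfolding act_def by blast
      then show ?thesis
        using that(2,3) ws_nth(1) unfolding act_def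
        by (intro bexI[of _ "\<delta> \<otimes>\<^bsub>\<Gamma>\<^esub> \<epsilon>"]) (simp_all add: composition_rule)
    qed
    have "act i (\<phi> \<gamma> u) (\<kappa> \<gamma> \<otimes>\<^bsub>Q\<^esub> q) \<longleftrightarrow> act i u q" if "i < n" for i
    proof
      assume "act i (\<phi> \<gamma> u) (\<kappa> \<gamma> \<otimes>\<^bsub>Q\<^esub> q)"
      from shift[OF this that, of "inv\<^bsub>\<Gamma>\<^esub> \<gamma>"] show "act i u q"
        using \<gamma> u q orbit_sym_aux[of \<gamma> u] by (simp flip: Q.m_assoc)
    qed (use shift that \<gamma> in blast)
    then show "(t \<gamma> \<otimes>\<^bsub>B\<^esub> h u a) y = (h (\<phi> \<gamma> u) a \<otimes>\<^bsub>B\<^esub> t \<gamma>) y"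
      using \<gamma> u a y A_closed[of "f a" y u] q
      by (simp add: B_apply hc tc \<phi>_closed)
         (auto simp: h_def t_def xq Y_def A_def intro!: restrict_ext)
  qed (use that hc tc \<phi>_closed in auto)

  \<comment> \<open>The state after the letters from position \<open>k\<close> on have acted:
    \<open>pt n\<close> is the base point, and \<open>pt 0\<close> the result of the whole
    word.\<close>
  define pt where "pt k = ((\<lambda>i\<in>{..<n}. if k \<le> i then g i else \<one>\<^bsub>F\<^esub>), \<one>\<^bsub>Q\<^esub>)" for k
  have pt_Y: "pt k \<in> Y" for k using ws_nth(4) by (auto simp: pt_def Y_def X_def)
  have W_drop: "drop k ws \<in> W" for k
    using ws(1) by (metis append_take_drop_id words_simps(3))
  have eval: "word_eval B h (drop k ws) (pt n) = pt k" if "k \<le> n" for k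
    using that
  proof (induction k rule: inc_induct)
    case base
    have "\<one>\<^bsub>B\<^esub> (pt n) = pt n" using pt_Y[of n] by (simp add: B_def BijGroup_def)
    then show ?case by (simp add: n_def)
  next
    case (step k)
    have eq: "drop k ws = (v k, snd (ws ! k)) # drop (Suc k) ws"
      using step.hyps by (simp add: v_def n_def Cons_nth_drop_Suc)
    have "word_eval B h (drop k ws) (pt n) = h (v k) (snd (ws ! k)) (pt (Suc k))"
      using step.IH step.hyps ws_nth(1,3)[of k] pt_Y
      by (simp add: eq B_apply hc word_eval_closed[OF B h W_drop])
    also have "\<dots> = A (v k) (g k) (pt (Suc k))" using pt_Y by (simp add: h_def g_def)
    also have "\<dots> = pt k"
    proof (rule Y_eqI)
      fix i assume i: "i < n"
      let ?x = "fst (pt (Suc k))"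
      have xj: "?x j = (if k < j then g j else \<one>\<^bsub>F\<^esub>)" if "j < n" for j
        using that by (simp add: pt_def Suc_le_eq)
      have blocked: "\<exists>j. a < j \<and> j < b \<and> v j \<noteq> v a \<and> {v a, v j} \<notin> E"
        if "a < b" "b < n" "v a = v b" for a b
        using reduced_word_between[OF ws(2)] that by (simp add: v_def n_def)
      have act_k: "act k (v k) \<one>\<^bsub>Q\<^esub>"
        using step.hyps ws_nth(1) by (auto simp: act_def id_eq_one[symmetric] intro!: bexI[of _ "\<one>\<^bsub>\<Gamma>\<^esub>"])
      \<comment> \<open>Only coordinate \<open>k\<close> moves. If \<open>v i = v k\<close> with
        \<open>i \<noteq> k\<close>, reducedness gives a blocking position \<open>j\<close> strictly
        between them. For \<open>i < k\<close>, \<open>cond i\<close> expects \<open>g j\<close>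
        where the identity stands; for \<open>k < i\<close>, it expects the identity where
        \<open>g j\<close> stands.\<close>
      have "act i (v k) \<one>\<^bsub>Q\<^esub> \<and> cond i ?x \<longleftrightarrow> i = k"
      proof
        assume ac: "act i (v k) \<one>\<^bsub>Q\<^esub> \<and> cond i ?x"
        have vik: "v i = v k" using act_eq act_k ac i step.hyps by blast
        show "i = k"
        proof (rule ccontr)
          assume "i \<noteq> k"
          then consider "i < k" | "k < i" by linarith
          then show False
          proof cases
            case 1
            then obtain j where j: "i < j" "j < k" "v j \<noteq> v i" "{v i, v j} \<notin> E"
              using blocked[of i k] vik step.hyps by auto
            then have "?x j = g j" using ac step.hyps by (auto simp: cond_def)
            then show False using xj[of j] j step.hyps ws_nth(5)[of j] by auto
          next
            case 2
            then obtain j where j: "k < j" "j < i" "v j \<noteq> v i" "{v i, v j} \<notin> E"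
              using blocked[of k i] vik i by auto
            then have "?x j = \<one>\<^bsub>F\<^esub>" using ac i by (auto simp: cond_def)
            then show False using xj[of j] j i ws_nth(5)[of j] by auto
          qed
        qed
      next
        assume ik: "i = k"
        show "act i (v k) \<one>\<^bsub>Q\<^esub> \<and> cond i ?x" using xj act_k by (auto simp: ik cond_def)
      qed
      moreover have "pt (Suc k) = (?x, \<one>\<^bsub>Q\<^esub>)" by (simp add: pt_def)
      ultimately have "fst (A (v k) (g k) (pt (Suc k))) i = (if i = k then g k \<otimes>\<^bsub>F\<^esub> ?x i else ?x i)"
        using A_nth[OF i] by metis
      then show "fst (A (v k) (g k) (pt (Suc k))) i = fst (pt k) i"
        using i xj[OF i] ws_nth(4)[OF i] by (auto simp: pt_def)
    qed (use step.hyps ws_nth(4) pt_Y A_closed in \<open>auto simp: pt_def A_def\<close>)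
    finally show ?case .
  qed

  obtain \<Psi> where \<Psi>: "\<Psi> \<in> hom GWP B"
    "\<And>xs \<gamma>. xs \<in> W \<Longrightarrow> \<gamma> \<in> carrier \<Gamma> \<Longrightarrow> \<Psi> (cls xs, \<gamma>) = word_eval B h xs \<otimes>\<^bsub>B\<^esub> t \<gamma>"
    using graph_wreath_product_universal[of B h t, OF B h comm t compat] by blast
  have "\<Psi> (cls ws, \<one>\<^bsub>\<Gamma>\<^esub>) = word_eval B h ws"
    using \<Psi>(2)[OF ws(1)] hom_one[OF t \<Gamma>.is_group B] word_eval_closed[OF B h ws(1)] by simp
  then have "\<Psi> (cls ws, \<one>\<^bsub>\<Gamma>\<^esub>) (pt n) = pt 0" using eval[of 0] by simp
  moreover have "fst (pt 0) 0 \<noteq> fst (pt n) 0"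
    using ws(3) ws_nth(5)[of 0] by (simp add: pt_def n_def)
  moreover have "\<one>\<^bsub>B\<^esub> (pt n) = pt n" using pt_Y by (simp add: B_def BijGroup_def)
  ultimately have "\<Psi> (cls ws, \<one>\<^bsub>\<Gamma>\<^esub>) \<noteq> \<one>\<^bsub>B\<^esub>" by metis
  then show thesis
    using \<Psi>(1) that[of \<Psi>] unfolding B_def Y_def X_def n_def by blast
qed

text \<open>For the identity maps on \<Delta> and \<Gamma>, \<open>sep\<close> only concerns the
  identity of \<Gamma>, where it is immediate.\<close>

lemma reduced_word_nontrivial:
  assumes "xs \<in> W" "reduced_word E \<Delta> xs" "xs \<noteq> []"
  shows "cls xs \<noteq> \<one>\<^bsub>GP\<^esub>"
proof
  assume eq: "cls xs = \<one>\<^bsub>GP\<^esub>"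
  have verts: "v \<in> V" if "v \<in> fst ` set xs" for v
    using that assms(1) unfolding free_product_words_def by (auto simp: in_lists_conv_set)
  obtain \<Psi> where \<Psi>: "\<Psi> \<in> hom GWP (BijGroup (({..<length xs} \<rightarrow>\<^sub>E carrier \<Delta>) \<times> carrier \<Gamma>))"
    "\<Psi> (cls xs, \<one>\<^bsub>\<Gamma>\<^esub>) \<noteq> \<one>\<^bsub>BijGroup (({..<length xs} \<rightarrow>\<^sub>E carrier \<Delta>) \<times> carrier \<Gamma>)\<^esub>"
  proof (rule separating_representation[of \<Delta> "\<lambda>a. a" \<Gamma> "\<lambda>\<gamma>. \<gamma>" xs])
    fix k v w assume "k = \<one>\<^bsub>\<Gamma>\<^esub>" "v \<in> fst ` set xs" "w \<in> fst ` set xs"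
    then show "(\<phi> k v = w \<longrightarrow> v = w) \<and> ({v, \<phi> k w} \<in> E \<longrightarrow> {v, w} \<in> E \<or> v = w \<and> comm_group \<Delta>)"
      using verts by (simp add: id_eq_one[symmetric])
  qed (use assms \<Delta>.is_group \<Gamma>.is_group in \<open>auto simp: hom_def reduced_word_def\<close>)
  then show False
    using hom_one[OF \<Psi>(1) graph_wreath_product_group group_BijGroup] by (simp add: eq)
qed

section \<open>Sufficiency of the conditions\<close>

lemma graph_wreath_product_residually_finite:
  assumes RF: "residually_finite \<Gamma>" "residually_finite \<Delta>"
    and sep: "(comm_group \<Delta> \<and>
        (\<forall>v\<in>V. \<forall>w\<in>V. {v, w} \<in> E \<longrightarrow> (\<exists>K. finite_index_subgroup \<Gamma> K \<and> w \<notin> (\<lambda>k. \<phi> k v) ` K))) \<or>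
      (\<forall>v\<in>V. \<exists>K. finite_index_subgroup \<Gamma> K \<and> (\<lambda>k. \<phi> k v) ` K \<inter> neighbours E v = {})"
    and sep': "\<forall>v\<in>V. \<forall>w\<in>V. {v, w} \<notin> E \<and> v \<noteq> w \<longrightarrow>
      (\<exists>K. finite_index_subgroup \<Gamma> K \<and> (\<lambda>k. \<phi> k w) ` K \<inter> (neighbours E v \<union> {v}) = {})"
  shows "residually_finite GWP"
  unfolding residually_finite_iff_separated
proof (intro ballI impI)
  \<comment> \<open>The elements of \<Gamma> that violate hypothesis \<open>sep\<close> of
    \<open>separating_representation\<close> at \<open>v\<close> and \<open>w\<close>, and so must
    survive in the finite quotient \<open>Q\<close>. Each such set misses a finite index subgroup or
    is empty.\<close>
  define bad where "bad v w = {k \<in> carrier \<Gamma>. (\<phi> k v = w \<and> v \<noteq> w) \<or>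
      ({v, \<phi> k w} \<in> E \<and> {v, w} \<notin> E \<and> \<not> (v = w \<and> comm_group \<Delta>))}" for v w
  have bad: "finitely_separated \<Gamma> (bad v w)" if v: "v \<in> V" and w: "w \<in> V" for v w
  proof -
    have *: ?thesis if "finite_index_subgroup \<Gamma> K" "\<And>k. k \<in> K \<Longrightarrow> k \<notin> bad v w" for K
    proof (rule finitely_separated_mono[OF finitely_separated_finite_index[OF \<Gamma>.is_group that(1)]])
      show "bad v w \<subseteq> carrier \<Gamma> - K" using that(2) unfolding bad_def by blast
    qed
    consider "v = w" "comm_group \<Delta>" | "v = w" "\<not> comm_group \<Delta>" | "{v, w} \<in> E" | "v \<noteq> w" "{v, w} \<notin> E"
      by blast
    then show ?thesis
    proof cases
      case 1
      then have "bad v w = {}" by (simp add: bad_def)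
      then show ?thesis by (simp add: finitely_separated_empty)
    next
      case 2
      \<comment> \<open>As \<Delta> is not abelian, the second alternative of \<open>sep\<close>
        holds.\<close>
      then obtain K where K: "finite_index_subgroup \<Gamma> K" "(\<lambda>k. \<phi> k v) ` K \<inter> neighbours E v = {}"
        using sep v by blast
      show ?thesis
        by (rule *[OF K(1)]) (use K(2) 2 in \<open>auto simp: bad_def neighbours_def\<close>)
    next
      case 3
      \<comment> \<open>Both alternatives of \<open>sep\<close> provide such a subgroup, the second
        because \<open>w\<close> itself is a neighbour of \<open>v\<close>.\<close>
      obtain K where K: "finite_index_subgroup \<Gamma> K" "w \<notin> (\<lambda>k. \<phi> k v) ` K"
        using sep
      proof
        assume "\<forall>v\<in>V. \<exists>K. finite_index_subgroup \<Gamma> K \<and> (\<lambda>k. \<phi> k v) ` K \<inter> neighbours E v = {}"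
        then obtain K where "finite_index_subgroup \<Gamma> K" "(\<lambda>k. \<phi> k v) ` K \<inter> neighbours E v = {}"
          using v by blast
        moreover have "w \<in> neighbours E v" by (simp add: neighbours_def 3)
        ultimately show thesis using that by blast
      qed (use 3 v w that in blast)
      show ?thesis
        by (rule *[OF K(1)]) (use K(2) 3 in \<open>auto simp: bad_def\<close>)
    next
      case 4
      then obtain K where K: "finite_index_subgroup \<Gamma> K"
          "(\<lambda>k. \<phi> k w) ` K \<inter> (neighbours E v \<union> {v}) = {}"
        using sep' v w by blast
      interpret K: subgroup K \<Gamma> using K(1) by (simp add: finite_index_subgroup_def)
      show ?thesis
      proof (rule *[OF K(1)])
        fix k assume k: "k \<in> K"
        \<comment> \<open>The condition speaks of translates of \<open>w\<close>; closure of
          \<open>K\<close> under inverses turns it into one on translates of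
          \<open>v\<close>.\<close>
        have "\<phi> k v \<noteq> w"
        proof
          assume "\<phi> k v = w"
          then have "\<phi> (inv\<^bsub>\<Gamma>\<^esub> k) w = v" by (rule orbit_sym_aux[OF K.mem_carrier[OF k] v])
          then show False using K(2) K.m_inv_closed[OF k] by blast
        qed
        moreover have "{v, \<phi> k w} \<notin> E" using K(2) k unfolding neighbours_def by blast
        ultimately show "k \<notin> bad v w" by (simp add: bad_def)
      qed
    qed
  qed
  fix x assume x: "x \<in> carrier GWP" "x \<noteq> \<one>\<^bsub>GWP\<^esub>"
  obtain X \<gamma> where X: "x = (X, \<gamma>)" "X \<in> carrier GP" "\<gamma> \<in> carrier \<Gamma>" using x(1) by auto
  show "finitely_separated GWP {x}"
  proof (cases "\<gamma> = \<one>\<^bsub>\<Gamma>\<^esub>")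
    case False
    then obtain H :: "nat monoid" and h where
      H: "group H" "finite (carrier H)" "h \<in> hom \<Gamma> H" "h \<gamma> \<noteq> \<one>\<^bsub>H\<^esub>"
      using RF(1) X(3) unfolding residually_finite_def by blast
    show ?thesis
      by (rule finitely_separatedI[OF H(1,2), where h = "h \<circ> snd"])
         (use H(3,4) X in \<open>auto simp: hom_def\<close>)
  next
    case True
    obtain ws where ws: "ws \<in> W" "X = cls ws" "reduced_word E \<Delta> ws"
      using reduced_word_exists[OF X(2)] .
    have ne: "ws \<noteq> []" using x(2) True X(1) ws(2) cls_Nil by auto
    have letters: "fst y \<in> V" "snd y \<in> carrier \<Delta>" "snd y \<noteq> \<one>\<^bsub>\<Delta>\<^esub>" if "y \<in> set ws" for y
      using that ws(1,3) unfolding free_product_words_def reduced_word_def by (auto simp: in_lists_conv_set)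
    have "finitely_separated \<Delta> (\<Union>y\<in>set ws. {snd y})"
      by (rule finitely_separated_UN)
         (use RF(2) letters in \<open>auto simp: residually_finite_iff_separated\<close>)
    then obtain F :: "nat monoid" and f where F: "group F" "finite (carrier F)" "f \<in> hom \<Delta> F"
      "\<forall>a\<in>(\<Union>y\<in>set ws. {snd y}). f a \<noteq> \<one>\<^bsub>F\<^esub>"
      unfolding finitely_separated_def by blast
    define S where "S = fst ` set ws"
    have S: "finite S" "S \<subseteq> V" using letters by (auto simp: S_def)
    \<comment> \<open>Only finitely many pairs of vertices occur in \<open>ws\<close>, so a single
      finite quotient of \<Gamma> handles all their bad elements.\<close>
    have "finitely_separated \<Gamma> (\<Union>(v, w)\<in>S \<times> S. bad v w)"
      by (rule finitely_separated_UN)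
         (use S bad in \<open>auto simp: bad_def subset_iff\<close>)
    then obtain Q :: "nat monoid" and \<kappa> where Q: "group Q" "finite (carrier Q)" "\<kappa> \<in> hom \<Gamma> Q"
      "\<forall>k\<in>(\<Union>(v, w)\<in>S \<times> S. bad v w). \<kappa> k \<noteq> \<one>\<^bsub>Q\<^esub>"
      unfolding finitely_separated_def by blast
    let ?Y = "({..<length ws} \<rightarrow>\<^sub>E carrier F) \<times> carrier Q"
    obtain \<Psi> where \<Psi>: "\<Psi> \<in> hom GWP (BijGroup ?Y)" "\<Psi> (cls ws, \<one>\<^bsub>\<Gamma>\<^esub>) \<noteq> \<one>\<^bsub>BijGroup ?Y\<^esub>"
    proof (rule separating_representation[of F f Q \<kappa> ws])
      fix k v w assume k: "k \<in> carrier \<Gamma>" "\<kappa> k = \<one>\<^bsub>Q\<^esub>" and "v \<in> fst ` set ws" "w \<in> fst ` set ws"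
      then have "(v, w) \<in> S \<times> S" by (simp add: S_def)
      then have "k \<notin> bad v w" using Q(4) k(2) by blast
      then show "(\<phi> k v = w \<longrightarrow> v = w) \<and> ({v, \<phi> k w} \<in> E \<longrightarrow> {v, w} \<in> E \<or> v = w \<and> comm_group \<Delta>)"
        using k(1) by (auto simp: bad_def)
    qed (use F Q ws ne in auto)
    have "finite ?Y" using F(2) Q(2) by (auto intro: finite_PiE)
    then show ?thesis
      using \<Psi> x(1) X(1) True ws(2)
      by (intro finitely_separatedI[OF group_BijGroup finite_BijGroup]) auto
  qed
qed

section \<open>Necessity of the conditions\<close>

lemma inj_acting_hom: "(\<lambda>\<gamma>. (\<one>\<^bsub>GP\<^esub>, \<gamma>)) \<in> hom \<Gamma> GWP"
  using hom_one[OF relabel_hom GP.is_group GP.is_group] by (intro homI) auto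

lemma inj_graph_product_hom: "(\<lambda>X. (X, \<one>\<^bsub>\<Gamma>\<^esub>)) \<in> hom GP GWP"
  by (intro homI) (auto simp: relabel_one)

text \<open>Common source of the necessary separation conditions: restrict a finite quotient in
  which the word survives to the vertex groups, giving \<open>e\<close>, and to \<Gamma>, whose
  kernel is \<open>K\<close>.\<close>

lemma finite_quotient_of_reduced_word:
  assumes RF: "residually_finite GWP" and xs: "xs \<in> W" "reduced_word E \<Delta> xs" "xs \<noteq> []"
  shows "\<exists>K (H :: nat monoid) e. finite_index_subgroup \<Gamma> K \<and> group H \<and> (\<forall>v\<in>V. e v \<in> hom \<Delta> H) \<and>
    (\<forall>v\<in>V. \<forall>w\<in>V. \<forall>a\<in>carrier \<Delta>. \<forall>b\<in>carrier \<Delta>. {v, w} \<in> E \<longrightarrow> e v a \<otimes>\<^bsub>H\<^esub> e w b = e w b \<otimes>\<^bsub>H\<^esub> e v a) \<and>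
    (\<forall>k\<in>K. \<forall>v\<in>V. \<forall>a\<in>carrier \<Delta>. e (\<phi> k v) a = e v a) \<and> word_eval H e xs \<noteq> \<one>\<^bsub>H\<^esub>"
proof -
  have "(cls xs, \<one>\<^bsub>\<Gamma>\<^esub>) \<in> carrier GWP" "(cls xs, \<one>\<^bsub>\<Gamma>\<^esub>) \<noteq> \<one>\<^bsub>GWP\<^esub>"
    using cls_carrier reduced_word_nontrivial xs by simp_all
  then obtain H :: "nat monoid" and h where
    H: "group H" "finite (carrier H)" "h \<in> hom GWP H" "h (cls xs, \<one>\<^bsub>\<Gamma>\<^esub>) \<noteq> \<one>\<^bsub>H\<^esub>"
    using RF unfolding residually_finite_def by blast
  interpret H: group H by fact
  interpret h: group_hom GWP H h
    using graph_wreath_product_group H by (simp add: group_hom_def group_hom_axioms_def)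
  define \<eta> where "\<eta> = h \<circ> (\<lambda>X. (X, \<one>\<^bsub>\<Gamma>\<^esub>))"
  define \<tau> where "\<tau> = h \<circ> (\<lambda>\<gamma>. (\<one>\<^bsub>GP\<^esub>, \<gamma>))"
  define e where "e v a = \<eta> (cls [(v, a)])" for v a
  have \<eta>: "\<eta> \<in> hom GP H" unfolding \<eta>_def by (rule hom_compose[OF inj_graph_product_hom H(3)])
  have \<tau>: "\<tau> \<in> hom \<Gamma> H" unfolding \<tau>_def by (rule hom_compose[OF inj_acting_hom H(3)])
  have \<eta>_mult: "\<eta> (cls (ys @ zs)) = \<eta> (cls ys) \<otimes>\<^bsub>H\<^esub> \<eta> (cls zs)" if "ys \<in> W" "zs \<in> W" for ys zs
    using \<eta> that by (simp add: cls_append hom_def cls_carrier)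
  have e: "e v \<in> hom \<Delta> H" if "v \<in> V" for v
    using hom_compose[OF cls_singleton[OF that] \<eta>] by (simp add: comp_def e_def[abs_def])
  have ec: "e v a \<in> carrier H" if "v \<in> V" "a \<in> carrier \<Delta>" for v a
    using e[OF that(1)] that(2) by (auto simp: hom_def)
  have e_eval: "\<eta> (cls ys) = word_eval H e ys" if "ys \<in> W" for ys
    using that
  proof (induction ys)
    case Nil
    then show ?case using hom_one[OF \<eta> GP.is_group H(1)] by (simp add: cls_Nil)
  next
    case (Cons y ys)
    then show ?case using \<eta>_mult[of "[y]" ys] by (cases y) (simp add: e_def)
  qed
  show ?thesis
  proof (intro exI[of _ "kernel \<Gamma> H \<tau>"] exI[of _ H] exI[of _ e] conjI ballI impI)
    show "finite_index_subgroup \<Gamma> (kernel \<Gamma> H \<tau>)"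
      by (rule finite_index_kernel[OF \<Gamma>.is_group H(1,2) \<tau>])
    fix v w a b assume "v \<in> V" "w \<in> V" "a \<in> carrier \<Delta>" "b \<in> carrier \<Delta>" "{v, w} \<in> E"
    note * = this(1,2,5,3,4)
    then show "e v a \<otimes>\<^bsub>H\<^esub> e w b = e w b \<otimes>\<^bsub>H\<^esub> e v a"
      using cls_commute[OF *] \<eta>_mult[of "[(v, a)]" "[(w, b)]"] \<eta>_mult[of "[(w, b)]" "[(v, a)]"]
      by (simp add: e_def)
  next
    fix k v a assume k: "k \<in> kernel \<Gamma> H \<tau>" and va: "v \<in> V" "a \<in> carrier \<Delta>"
    have k\<Gamma>: "k \<in> carrier \<Gamma>" and k1: "h (\<one>\<^bsub>GP\<^esub>, k) = \<one>\<^bsub>H\<^esub>"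
      using k by (auto simp: kernel_def \<tau>_def)
    have C: "cls [(v, a)] \<in> carrier GP" "cls [(\<phi> k v, a)] \<in> carrier GP"
      using va k\<Gamma> by (simp_all add: cls_carrier \<phi>_closed)
    \<comment> \<open>In the semidirect product, conjugation by \<open>k\<close> carries the letter
      at \<open>v\<close> to the letter at \<open>\<phi> k v\<close>; since \<open>k\<close> has
      trivial image, both letters have the same image.\<close>
    have "(\<one>\<^bsub>GP\<^esub>, k) \<otimes>\<^bsub>GWP\<^esub> (cls [(v, a)], \<one>\<^bsub>\<Gamma>\<^esub>) = (cls [(\<phi> k v, a)], \<one>\<^bsub>\<Gamma>\<^esub>) \<otimes>\<^bsub>GWP\<^esub> (\<one>\<^bsub>GP\<^esub>, k)"
      using va k\<Gamma> C by (simp add: relabel_cls relabel_one)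
    then have "h (\<one>\<^bsub>GP\<^esub>, k) \<otimes>\<^bsub>H\<^esub> e v a = e (\<phi> k v) a \<otimes>\<^bsub>H\<^esub> h (\<one>\<^bsub>GP\<^esub>, k)"
      using k\<Gamma> C h.hom_mult[of "(\<one>\<^bsub>GP\<^esub>, k)" "(cls [(v, a)], \<one>\<^bsub>\<Gamma>\<^esub>)"]
        h.hom_mult[of "(cls [(\<phi> k v, a)], \<one>\<^bsub>\<Gamma>\<^esub>)" "(\<one>\<^bsub>GP\<^esub>, k)"]
      by (simp add: e_def \<eta>_def del: GWP_simps(3))
    then show "e (\<phi> k v) a = e v a"
      using va k\<Gamma> by (simp add: k1 ec \<phi>_closed)
  next
    show "word_eval H e xs \<noteq> \<one>\<^bsub>H\<^esub>"
      using H(4) e_eval[OF xs(1)] by (simp add: \<eta>_def)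
  qed (use H e in auto)
qed

text \<open>Residual finiteness passes to subgroups: \<Gamma> embeds as the acting factor, and
  \<Delta> as any vertex group because nontrivial one-letter words are reduced.\<close>

lemma graph_wreath_product_residually_finite_factors:
  assumes "residually_finite GWP" "V \<noteq> {}"
  shows "residually_finite \<Gamma>" "residually_finite \<Delta>"
proof -
  show "residually_finite \<Gamma>"
    by (rule residually_finite_inj_hom[OF assms(1) graph_wreath_product_group \<Gamma>.is_group inj_acting_hom])
       simp
  obtain v where v: "v \<in> V" using assms(2) by blast
  have "(\<lambda>X. (X, \<one>\<^bsub>\<Gamma>\<^esub>)) \<circ> (\<lambda>a. cls [(v, a)]) \<in> hom \<Delta> GWP"
    by (rule hom_compose[OF cls_singleton[OF v] inj_graph_product_hom])
  then show "residually_finite \<Delta>"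
  proof (rule residually_finite_inj_hom[OF assms(1) graph_wreath_product_group \<Delta>.is_group])
    fix a assume "a \<in> carrier \<Delta>" "a \<noteq> \<one>\<^bsub>\<Delta>\<^esub>"
    then show "((\<lambda>X. (X, \<one>\<^bsub>\<Gamma>\<^esub>)) \<circ> (\<lambda>a. cls [(v, a)])) a \<noteq> \<one>\<^bsub>GWP\<^esub>"
      using v reduced_word_nontrivial[of "[(v, a)]"]
      by (simp add: reduced_word_def Cons_eq_append_conv)
  qed
qed

text \<open>The word with letters \<open>a\<close> at \<open>v\<close> and its inverse at
  \<open>w\<close> is reduced, but it would die if some \<open>k\<close> in \<open>K\<close> moved
  \<open>v\<close> to \<open>w\<close>.\<close>

lemma separation_of_vertices:
  assumes RF: "residually_finite GWP" and "carrier \<Delta> \<noteq> {\<one>\<^bsub>\<Delta>\<^esub>}"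
    and vw: "v \<in> V" "w \<in> V" "v \<noteq> w"
  shows "\<exists>K. finite_index_subgroup \<Gamma> K \<and> w \<notin> (\<lambda>k. \<phi> k v) ` K"
proof -
  obtain a where a: "a \<in> carrier \<Delta>" "a \<noteq> \<one>\<^bsub>\<Delta>\<^esub>" using assms(2) \<Delta>.one_closed by blast
  let ?xs = "[(v, a), (w, inv\<^bsub>\<Delta>\<^esub> a)]"
  have xs: "?xs \<in> W" "reduced_word E \<Delta> ?xs"
    using a vw by (auto simp: reduced_word_def Cons_eq_append_conv)
  obtain K and H :: "nat monoid" and e where
    K: "finite_index_subgroup \<Gamma> K" and H: "group H" and e: "\<forall>v\<in>V. e v \<in> hom \<Delta> H"
    and inv: "\<forall>k\<in>K. \<forall>v\<in>V. \<forall>a\<in>carrier \<Delta>. e (\<phi> k v) a = e v a"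
    and ne: "word_eval H e ?xs \<noteq> \<one>\<^bsub>H\<^esub>"
    using finite_quotient_of_reduced_word[OF RF xs] by auto
  interpret H: group H by fact
  interpret ev: group_hom \<Delta> H "e v" using bspec[OF e vw(1)] by unfold_locales
  have "\<phi> k v \<noteq> w" if "k \<in> K" for k
  proof
    assume "\<phi> k v = w"
    then have "e w (inv\<^bsub>\<Delta>\<^esub> a) = inv\<^bsub>H\<^esub> (e v a)" using inv that vw(1) a \<Delta>.inv_closed ev.hom_inv by metis
    then show False using ne a by simp
  qed
  then show ?thesis using K by blast
qed

text \<open>A nontrivial commutator of \<Delta>, placed at \<open>v\<close>, survives in a finite
  quotient. If \<open>\<phi> k v\<close> were adjacent to \<open>v\<close>, the images of
  \<open>a\<close> and \<open>b\<close> at \<open>v\<close> would commute, since \<open>b\<close>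
  has the same image at both vertices.\<close>

lemma separation_of_loops:
  assumes RF: "residually_finite GWP" and "\<not> comm_group \<Delta>" and v: "v \<in> V"
  shows "\<exists>K. finite_index_subgroup \<Gamma> K \<and> (\<lambda>k. \<phi> k v) ` K \<inter> neighbours E v = {}"
proof -
  obtain a b where ab: "a \<in> carrier \<Delta>" "b \<in> carrier \<Delta>" "a \<otimes>\<^bsub>\<Delta>\<^esub> b \<noteq> b \<otimes>\<^bsub>\<Delta>\<^esub> a"
    using assms(2) \<Delta>.group_comm_groupI by blast
  let ?c = "(a \<otimes>\<^bsub>\<Delta>\<^esub> b) \<otimes>\<^bsub>\<Delta>\<^esub> inv\<^bsub>\<Delta>\<^esub> (b \<otimes>\<^bsub>\<Delta>\<^esub> a)"
  have "?c \<noteq> \<one>\<^bsub>\<Delta>\<^esub>"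
    using ab by (metis \<Delta>.inv_closed \<Delta>.inv_equality \<Delta>.inv_inv \<Delta>.m_closed)
  then have xs: "[(v, ?c)] \<in> W" "reduced_word E \<Delta> [(v, ?c)]"
    using ab v by (auto simp: reduced_word_def Cons_eq_append_conv)
  obtain K and H :: "nat monoid" and e where
    K: "finite_index_subgroup \<Gamma> K" and H: "group H" and e: "\<forall>v\<in>V. e v \<in> hom \<Delta> H"
    and comm: "\<forall>v\<in>V. \<forall>w\<in>V. \<forall>a\<in>carrier \<Delta>. \<forall>b\<in>carrier \<Delta>.
      {v, w} \<in> E \<longrightarrow> e v a \<otimes>\<^bsub>H\<^esub> e w b = e w b \<otimes>\<^bsub>H\<^esub> e v a"
    and inv: "\<forall>k\<in>K. \<forall>v\<in>V. \<forall>a\<in>carrier \<Delta>. e (\<phi> k v) a = e v a"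
    and ne: "word_eval H e [(v, ?c)] \<noteq> \<one>\<^bsub>H\<^esub>"
    using finite_quotient_of_reduced_word[OF RF xs] by auto
  interpret H: group H by fact
  interpret ev: group_hom \<Delta> H "e v" using bspec[OF e v] by unfold_locales
  have K_sub: "k \<in> carrier \<Gamma>" if "k \<in> K" for k
    using K that by (auto simp: finite_index_subgroup_def dest: subgroup.mem_carrier)
  have "{v, \<phi> k v} \<notin> E" if k: "k \<in> K" for k
  proof
    assume "{v, \<phi> k v} \<in> E"
    then have "e v a \<otimes>\<^bsub>H\<^esub> e (\<phi> k v) b = e (\<phi> k v) b \<otimes>\<^bsub>H\<^esub> e v a"
      using comm v ab \<phi>_closed[OF K_sub[OF k] v] by blast
    moreover have "e (\<phi> k v) b = e v b" using inv k v ab by blast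
    ultimately have "e v a \<otimes>\<^bsub>H\<^esub> e v b = e v b \<otimes>\<^bsub>H\<^esub> e v a" by simp
    then show False using ne ab by simp
  qed
  then show ?thesis using K by (auto simp: neighbours_def)
qed

text \<open>The commutator of \<open>a\<close> at \<open>v\<close> with \<open>a\<close> at
  \<open>w\<close> is a reduced word. If \<open>K\<close> moved \<open>w\<close> to \<open>v\<close>
  or to a neighbour of \<open>v\<close>, the images of these letters would coincide or
  commute.\<close>

lemma separation_of_non_neighbours:
  assumes RF: "residually_finite GWP" and "carrier \<Delta> \<noteq> {\<one>\<^bsub>\<Delta>\<^esub>}"
    and vw: "v \<in> V" "w \<in> V" "v \<noteq> w" "{v, w} \<notin> E"
  shows "\<exists>K. finite_index_subgroup \<Gamma> K \<and> (\<lambda>k. \<phi> k w) ` K \<inter> (neighbours E v \<union> {v}) = {}"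
proof -
  obtain a where a: "a \<in> carrier \<Delta>" "a \<noteq> \<one>\<^bsub>\<Delta>\<^esub>" using assms(2) \<Delta>.one_closed by blast
  let ?xs = "[(v, a), (w, a), (v, inv\<^bsub>\<Delta>\<^esub> a), (w, inv\<^bsub>\<Delta>\<^esub> a)]"
  have xs: "?xs \<in> W" "reduced_word E \<Delta> ?xs"
    using a vw by (auto simp: reduced_word_def Cons_eq_append_conv insert_commute)
  obtain K and H :: "nat monoid" and e where
    K: "finite_index_subgroup \<Gamma> K" and H: "group H" and e: "\<forall>v\<in>V. e v \<in> hom \<Delta> H"
    and comm: "\<forall>v\<in>V. \<forall>w\<in>V. \<forall>a\<in>carrier \<Delta>. \<forall>b\<in>carrier \<Delta>.
      {v, w} \<in> E \<longrightarrow> e v a \<otimes>\<^bsub>H\<^esub> e w b = e w b \<otimes>\<^bsub>H\<^esub> e v a"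
    and inv: "\<forall>k\<in>K. \<forall>v\<in>V. \<forall>a\<in>carrier \<Delta>. e (\<phi> k v) a = e v a"
    and ne: "word_eval H e ?xs \<noteq> \<one>\<^bsub>H\<^esub>"
    using finite_quotient_of_reduced_word[OF RF xs] by auto
  interpret H: group H by fact
  interpret ev: group_hom \<Delta> H "e v" using bspec[OF e vw(1)] by unfold_locales
  interpret ew: group_hom \<Delta> H "e w" using bspec[OF e vw(2)] by unfold_locales
  have K_sub: "k \<in> carrier \<Gamma>" if "k \<in> K" for k
    using K that by (auto simp: finite_index_subgroup_def dest: subgroup.mem_carrier)
  have ncomm: "e v a \<otimes>\<^bsub>H\<^esub> e w a \<noteq> e w a \<otimes>\<^bsub>H\<^esub> e v a"
  proof
    let ?x = "e v a" and ?y = "e w a"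
    have xy: "?x \<in> carrier H" "?y \<in> carrier H" using a by simp_all
    assume "?x \<otimes>\<^bsub>H\<^esub> ?y = ?y \<otimes>\<^bsub>H\<^esub> ?x"
    then have "(?x \<otimes>\<^bsub>H\<^esub> ?y) \<otimes>\<^bsub>H\<^esub> inv\<^bsub>H\<^esub> (?y \<otimes>\<^bsub>H\<^esub> ?x) = \<one>\<^bsub>H\<^esub>" using xy by simp
    then have "?x \<otimes>\<^bsub>H\<^esub> (?y \<otimes>\<^bsub>H\<^esub> (inv\<^bsub>H\<^esub> ?x \<otimes>\<^bsub>H\<^esub> inv\<^bsub>H\<^esub> ?y)) = \<one>\<^bsub>H\<^esub>"
      using xy by (simp add: H.inv_mult_group H.m_assoc)
    then show False using ne a by simp
  qed
  have "\<phi> k w \<notin> neighbours E v \<union> {v}" if k: "k \<in> K" for k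
  proof
    have u: "\<phi> k w \<in> V" "e (\<phi> k w) a = e w a" using k vw a K_sub inv by (auto simp: \<phi>_closed)
    assume "\<phi> k w \<in> neighbours E v \<union> {v}"
    then consider "{v, \<phi> k w} \<in> E" | "\<phi> k w = v" by (auto simp: neighbours_def)
    then show False
      using ncomm u comm vw(1) a(1) by cases metis+
  qed
  then show ?thesis using K by blast
qed

end

theorem theorem1p1:
  fixes \<Gamma> :: "('g, 'n) monoid_scheme"
    and \<Delta> :: "('d, 'm) monoid_scheme"
    and V :: "'v set" and E :: "'v set set"
    and \<phi> :: "'g \<Rightarrow> 'v \<Rightarrow> 'v"
  assumes "group \<Gamma>" and "group \<Delta>"
    and "simplicial_graph V E"
    and "group_action \<Gamma> V \<phi>"
    and "\<forall>\<gamma>\<in>carrier \<Gamma>. graph_automorphism V E (\<phi> \<gamma>)"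
    and "V \<noteq> {}" and "carrier \<Delta> \<noteq> {\<one>\<^bsub>\<Delta>\<^esub>}"
  shows "residually_finite (graph_wreath_product V E \<Delta> \<Gamma> \<phi>) \<longleftrightarrow>
    (residually_finite \<Gamma> \<and> residually_finite \<Delta>) \<and>
    ((comm_group \<Delta> \<and>
        (\<forall>v\<in>V. \<forall>w\<in>V. {v, w} \<in> E \<longrightarrow>
          (\<exists>K. finite_index_subgroup \<Gamma> K \<and> w \<notin> (\<lambda>k. \<phi> k v) ` K))) \<or>
     (\<forall>v\<in>V. \<exists>K. finite_index_subgroup \<Gamma> K \<and> (\<lambda>k. \<phi> k v) ` K \<inter> neighbours E v = {})) \<and>
    (\<forall>v\<in>V. \<forall>w\<in>V. {v, w} \<notin> E \<and> v \<noteq> w \<longrightarrow>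
      (\<exists>K. finite_index_subgroup \<Gamma> K \<and> (\<lambda>k. \<phi> k w) ` K \<inter> (neighbours E v \<union> {v}) = {}))"
proof -
  interpret graph_wreath V E \<Delta> \<Gamma> \<phi>
    using assms by (simp add: graph_wreath_def graph_wreath_axioms_def)
  show ?thesis
  proof (intro iffI conjI)
    assume RF: "residually_finite GWP"
    show "residually_finite \<Gamma>" "residually_finite \<Delta>"
      using graph_wreath_product_residually_finite_factors[OF RF] assms(6) by auto
    \<comment> \<open>Commutativity of \<Delta> decides the alternative. In the abelian case
      adjacent vertices are distinct, so they can be separated.\<close>
    show "(comm_group \<Delta> \<and>
        (\<forall>v\<in>V. \<forall>w\<in>V. {v, w} \<in> E \<longrightarrow>
          (\<exists>K. finite_index_subgroup \<Gamma> K \<and> w \<notin> (\<lambda>k. \<phi> k v) ` K))) \<or>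
      (\<forall>v\<in>V. \<exists>K. finite_index_subgroup \<Gamma> K \<and> (\<lambda>k. \<phi> k v) ` K \<inter> neighbours E v = {})"
    proof (cases "comm_group \<Delta>")
      case True
      then show ?thesis using separation_of_vertices[OF RF assms(7)] no_loop by metis
    next
      case False
      then show ?thesis using separation_of_loops[OF RF] by blast
    qed
    show "\<forall>v\<in>V. \<forall>w\<in>V. {v, w} \<notin> E \<and> v \<noteq> w \<longrightarrow>
      (\<exists>K. finite_index_subgroup \<Gamma> K \<and> (\<lambda>k. \<phi> k w) ` K \<inter> (neighbours E v \<union> {v}) = {})"
      using separation_of_non_neighbours[OF RF assms(7)] by blast
  qed (use graph_wreath_product_residually_finite in blast)
qed

end
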